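(* Let $r\ge 1$ and $d\ge 1$ be integers and let $f\in C(I^d)$. Let (A), (B), (C) denote the three estimates displayed in the context. (i) If $0<\alpha\le r$ and $\Psi_r(f,n)=O(2^{-n\alpha})$, then (A) implies $|\Delta^r_{te_i}f(x)|=O(t^\alpha)$ (for $1\le i\le d$ and $x,\,x+rte_i\in I^d$). (ii) If $0<\alpha<r$ and $\Psi_r(f,n)=O(2^{-n\alpha})$, then (B) implies $\omega^r(f,t)=O(t^\alpha)$. (iii) However, for $\alpha=r$, $d>1$ and $r>1$ (that is, when $\Psi_r(f,n)=O(2^{-nr})$), there are examples (known from the earlier literature) showing that $\omega^r(f,t)$ may behave like $t^r|\log t|$, and hence the extra terms in (B) are not redundant. (iv) If $r=1$, $0<\alpha\le 1$ and $\Psi_1(f,n)=O(2^{-n\alpha})$, then $\omega(f,t)=\omega^1(f,t)=O(t^\alpha)$, using (C).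
   Context: $I^d=[0,1]^d$; $C(I^d)$ is the space of continuous functions on $I^d$ and $\|f\|$ is the supremum norm; $|h|$ is the Euclidean norm of $h\in\mathbb{R}^d$; $e_i$ is the unit vector in the $i$-th coordinate direction of $\mathbb{R}^d$. For $h\in\mathbb{R}^d$ with $x,x+rh\in I^d$, $\Delta^r_h f(x)=\sum_{k=0}^r(-1)^{r-k}\binom{r}{k}f(x+kh)$. The $r$-th modulus of smoothness is $\omega^r(f,t)=\sup\{|\Delta^r_h f(x)| : |h|\le t,\ x,\,x+rh\in I^d\}$, and $\omega(f,t)=\omega^1(f,t)$. For an integer $n$, $$\Psi_r(f,n)=\sup\bigl\{|\Delta^r_{2^{-n}e_i}f(2^{-n}\kappa)| : 1\le i\le d,\ \kappa\in\mathbb{Z}^d,\ 2^{-n}\kappa\in I^d,\ 2^{-n}(\kappa+re_i)\in I^d\bigr\},$$ with the convention that the supremum of the empty set is $0$. $O$-relations for $\Psi_r(f,n)$ are as $n\to\infty$, and those in $t$ are as $t\to0^+$. The paper's main theorem provides, for $f\in C(I^d)$ and with constants $M_1(r,d)$, $M_2(r,d)$, $M$ independent of $n$ and $f$, the following estimates. (A) $|\Delta^r_{te_i}f(u)|\le M_1(r,d)\sum_{k=0}^\infty\Psi_r(f,n+k)$ for $u,\,u+rte_i\in I^d$ and $t\le 2^{-n}$. (B) $\omega^r(f,t)\le M_2(r,d)\Bigl(\sum_{k=0}^\infty\Psi_r(f,n+k)+\sum_{k=1}^{n_0}2^{-kr}\Psi_r(f,n-k)+t^r\|f\|\Bigr)$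 for $2^{-n-1}<t\le 2^{-n}$, where $n_0$ is the largest integer satisfying $r2^{n_0-n-1}\le 1$. The "extra terms" are those in (B) beyond the sum $\sum_{k=0}^\infty\Psi_r(f,n+k)$ that appears in (A). (C) For $r=1$: $\omega(f,t)\le M\sum_{k=0}^\infty\Psi_1(f,n+k)$ for $t\le 2^{-n}$. *)

theory Defs
  imports "HOL-Analysis.Analysis" "HOL-Library.Landau_Symbols"
begin

definition unit_cube :: "(real^'d) set" where
  "unit_cube = {x. \<forall>i. 0 \<le> x $ i \<and> x $ i \<le> 1}"

definition fwd_diff :: "nat \<Rightarrow> real^'d \<Rightarrow> (real^'d \<Rightarrow> real) \<Rightarrow> real^'d \<Rightarrow> real" where
  "fwd_diff r h f x =
     (\<Sum>k=0..r. (-1) ^ (r - k) * real (r choose k) * f (x + real k *\<^sub>R h))"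

text \<open>
  The suprema below are suprema of sets of reals, meaningful because they are used only for
  \<open>f\<close> continuous on the cube, where the sets are bounded above. The sets are nonempty for the
  supremum norm and, if \<open>t \<ge> 0\<close>, for the modulus of smoothness.
\<close>

definition cube_norm :: "(real^'d \<Rightarrow> real) \<Rightarrow> real" where
  "cube_norm f = (SUP x\<in>unit_cube. \<bar>f x\<bar>)"

definition smooth_modulus :: "nat \<Rightarrow> (real^'d \<Rightarrow> real) \<Rightarrow> real \<Rightarrow> real" where
  "smooth_modulus r f t =
     Sup {\<bar>fwd_diff r h f x\<bar> | h x.
            norm h \<le> t \<and> x \<in> unit_cube \<and> x + real r *\<^sub>R h \<in> unit_cube}"

definition grid_point :: "int \<Rightarrow> int^'d \<Rightarrow> real^'d" where
  "grid_point n \<kappa> = 2 powi (- n) *\<^sub>R (\<chi> j. of_int (\<kappa> $ j))"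

definition dyadic_diffs :: "nat \<Rightarrow> (real^'d \<Rightarrow> real) \<Rightarrow> int \<Rightarrow> real set" where
  "dyadic_diffs r f n =
     {\<bar>fwd_diff r (2 powi (- n) *\<^sub>R axis i 1) f (grid_point n \<kappa>)\<bar> | i \<kappa>.
        grid_point n \<kappa> \<in> unit_cube \<and> grid_point n (\<kappa> + axis i (int r)) \<in> unit_cube}"

text \<open>The set is empty when \<open>r * 2 powi (- n) > 1\<close>; the supremum is then \<open>0\<close> by convention.\<close>

definition Psi :: "nat \<Rightarrow> (real^'d \<Rightarrow> real) \<Rightarrow> int \<Rightarrow> real" where
  "Psi r f n = (if dyadic_diffs r f n = {} then 0 else Sup (dyadic_diffs r f n))"

text \<open>
  The series may diverge for a continuous \<open>f\<close>; it is taken in \<open>[0, \<infinity>]\<close>, so that an estimate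
  with a divergent right-hand side carries no information.
\<close>

definition Psi_tail :: "nat \<Rightarrow> (real^'d \<Rightarrow> real) \<Rightarrow> int \<Rightarrow> ennreal" where
  "Psi_tail r f n = (\<Sum>k::nat. ennreal (Psi r f (n + int k)))"

definition estimate_A :: "real \<Rightarrow> nat \<Rightarrow> (real^'d \<Rightarrow> real) \<Rightarrow> bool" where
  "estimate_A M r f \<longleftrightarrow>
     (\<forall>(n::int) t i u. 0 < t \<longrightarrow> t \<le> 2 powi (- n) \<longrightarrow>
        u \<in> unit_cube \<longrightarrow> u + (real r * t) *\<^sub>R axis i 1 \<in> unit_cube \<longrightarrow>
        ennreal \<bar>fwd_diff r (t *\<^sub>R axis i 1) f u\<bar> \<le> ennreal M * Psi_tail r f n)"

definition coarse_levels :: "nat \<Rightarrow> int \<Rightarrow> int" where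
  "coarse_levels r n = (GREATEST m::int. real r * 2 powi (m - n - 1) \<le> 1)"

definition coarse_sum :: "nat \<Rightarrow> (real^'d \<Rightarrow> real) \<Rightarrow> int \<Rightarrow> real" where
  "coarse_sum r f n =
     (\<Sum>k\<in>{1..coarse_levels r n}. 2 powi (- (k * int r)) * Psi r f (n - k))"

definition estimate_B :: "real \<Rightarrow> nat \<Rightarrow> (real^'d \<Rightarrow> real) \<Rightarrow> bool" where
  "estimate_B M r f \<longleftrightarrow>
     (\<forall>(n::int) t. 2 powi (- n - 1) < t \<longrightarrow> t \<le> 2 powi (- n) \<longrightarrow>
        ennreal (smooth_modulus r f t) \<le>
          ennreal M * (Psi_tail r f n + ennreal (coarse_sum r f n) + ennreal (t ^ r * cube_norm f)))"

end

theory Submission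
  imports Defs "HOL-Complex_Analysis.Cauchy_Integral_Formula"
begin

text \<open>
  Parts (i) and (ii) sum geometric series in the estimates (A) and (B) at the dyadic level
  \<open>n\<close> with \<open>2\<^sup>-\<^sup>n\<close> comparable to \<open>t\<close>; in (ii) the coarse levels contribute
  \<open>\<Sum>k. 2 powr (- k (r - \<alpha>))\<close>, which converges because \<open>\<alpha> < r\<close>. Part (iv) chains a point to its
  coordinatewise dyadic roundings, consecutive ones being at most one grid step apart in each
  coordinate.

  For (iii) take \<open>g = x\<^sup>r\<^sup>-\<^sup>1 y ln (x + y)\<close> in two of the coordinates. Along a segment with
  direction \<open>(p, q)\<close> the \<open>r\<close>-th derivative of \<open>g\<close> is \<open>r! p\<^sup>r\<^sup>-\<^sup>1 q ln (x + y)\<close> up to an error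
  \<open>O((\<bar>p\<bar> + \<bar>q\<bar>)\<^sup>r)\<close>. The logarithmic term vanishes in the axis directions, so the differences
  seen by \<open>\<Psi>\<^sub>r\<close> are \<open>O(2\<^sup>-\<^sup>n\<^sup>r)\<close>, but in the diagonal direction, at distance \<open>t\<close> from the face
  \<open>x = y = 0\<close>, it produces \<open>t\<^sup>r \<bar>ln t\<bar>\<close>.
\<close>

subsection \<open>Dyadic levels and geometric sums\<close>

lemma two_powi_eq_powr: "(2::real) powi n = 2 powr (of_int n)"
  by (simp add: powr_real_of_int')

text \<open>The level is exposed as a floor so that \<open>t < 1\<close> immediately yields
  \<open>0 \<le> n\<close>.\<close>

lemma dyadic_scale:
  fixes t :: real
  assumes "0 < t"
  obtains n :: int where "2 powi (- n - 1) < t" "t \<le> 2 powi (- n)" "n = \<lfloor>- log 2 t\<rfloor>"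
proof
  let ?n = "\<lfloor>- log 2 t\<rfloor>"
  have *: "2 powr log 2 t = t" using assms by simp
  have "2 powr (- of_int ?n - 1) < 2 powr log 2 t"
    by (rule powr_less_mono) linarith+
  then show "2 powi (- ?n - 1) < t" by (simp add: two_powi_eq_powr *)
  have "2 powr log 2 t \<le> 2 powr (- of_int ?n)"
    by (rule powr_mono) linarith+
  then show "t \<le> 2 powi (- ?n)" by (simp add: two_powi_eq_powr *)
qed simp

text \<open>Only finitely many integer levels lie between \<open>m\<close> and the threshold of the
  O-relation, so enlarging the constant makes the bound valid from \<open>m\<close> on.\<close>

lemma Psi_bigo_bound:
  assumes "Psi r f \<in> O[at_top](\<lambda>n. 2 powr (- of_int n * \<alpha>))"
  obtains C where "0 \<le> C" "\<And>j. m \<le> j \<Longrightarrow> \<bar>Psi r f j\<bar> \<le> C * 2 powr (- of_int j * \<alpha>)"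
proof -
  obtain c where c: "c > 0" "\<forall>\<^sub>F n in at_top. \<bar>Psi r f n\<bar> \<le> c * 2 powr (- of_int n * \<alpha>)"
    using assms by (elim landau_o.bigE) auto
  then obtain N where N: "\<And>n. N \<le> n \<Longrightarrow> \<bar>Psi r f n\<bar> \<le> c * 2 powr (- of_int n * \<alpha>)"
    by (auto simp: eventually_at_top_linorder)
  \<comment> \<open>\<open>S\<close> adds the normalised values at the levels up to the threshold,
    hence dominates each of them.\<close>
  define S where "S = (\<Sum>j\<in>{m..N}. \<bar>Psi r f j\<bar> * 2 powr (of_int j * \<alpha>))"
  have S: "0 \<le> S" by (auto simp: S_def intro: sum_nonneg)
  show thesis
  proof
    show "0 \<le> c + S" using c S by simp
    fix j assume j: "m \<le> j"
    show "\<bar>Psi r f j\<bar> \<le> (c + S) * 2 powr (- of_int j * \<alpha>)"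
    proof (cases "N \<le> j")
      case True
      have "c * 2 powr (- of_int j * \<alpha>) \<le> (c + S) * 2 powr (- of_int j * \<alpha>)"
        using S by (intro mult_right_mono) auto
      with N[OF True] show ?thesis by (rule order_trans)
    next
      case False
      have "\<bar>Psi r f j\<bar> * 2 powr (of_int j * \<alpha>) \<le> S"
        unfolding S_def by (rule member_le_sum) (use j False in auto)
      then have "\<bar>Psi r f j\<bar> \<le> S * 2 powr (- of_int j * \<alpha>)"
        by (simp add: powr_minus field_simps)
      also have "\<dots> \<le> (c + S) * 2 powr (- of_int j * \<alpha>)"
        using c by (intro mult_right_mono) auto
      finally show ?thesis .
    qed
  qed
qed

text \<open>Consecutive bounds have ratio \<open>2 powr - \<alpha>\<close>, which is below 1 because
  \<open>\<alpha>\<close> is positive; the tail is therefore comparable to its first term.\<close>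

lemma Psi_tail_le_geometric:
  assumes "\<And>j. n \<le> j \<Longrightarrow> Psi r f j \<le> C * 2 powr (- of_int j * \<alpha>)" "0 < \<alpha>" "0 \<le> C"
  shows "Psi_tail r f n \<le> ennreal (C / (1 - 2 powr - \<alpha>) * 2 powr (- of_int n * \<alpha>))"
proof -
  have lt: "2 powr - \<alpha> < (1::real)" using assms(2) by (simp add: powr_less_one)
  have s: "(\<lambda>k. C * 2 powr (- of_int n * \<alpha>) * (2 powr - \<alpha>) ^ k) sums
      (C * 2 powr (- of_int n * \<alpha>) * (1 / (1 - 2 powr - \<alpha>)))"
    by (intro sums_mult geometric_sums) (use lt in auto)
  have "Psi_tail r f n \<le> (\<Sum>k. ennreal (C * 2 powr (- of_int n * \<alpha>) * (2 powr - \<alpha>) ^ k))"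
    unfolding Psi_tail_def
  proof (intro suminf_le ennreal_leI)
    fix k :: nat
    have "2 powr (- of_int (n + int k) * \<alpha>) = 2 powr (- of_int n * \<alpha>) * (2 powr - \<alpha>) ^ k"
      by (simp add: powr_add[symmetric] powr_realpow[symmetric] powr_powr algebra_simps)
    with assms(1)[of "n + int k"]
    show "Psi r f (n + int k) \<le> C * 2 powr (- of_int n * \<alpha>) * (2 powr - \<alpha>) ^ k" by simp
  qed auto
  also have "\<dots> = ennreal (C * 2 powr (- of_int n * \<alpha>) * (1 / (1 - 2 powr - \<alpha>)))"
    by (rule suminf_ennreal_eq) (use s assms(3) in auto)
  finally show ?thesis by (simp add: field_simps)
qed

text \<open>This keeps every level \<open>n - k\<close> of the coarse sum at -1 or above, so one
  constant for the levels from -1 on serves all \<open>n\<close>.\<close>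

lemma coarse_levels_le:
  assumes "1 \<le> r"
  shows "coarse_levels r n \<le> n + 1"
proof -
  let ?m = "n + 1 - \<lceil>log 2 r\<rceil>"
  \<comment> \<open>Taking logarithms turns the condition on \<open>m\<close> into an integer upper
    bound, whose greatest solution is explicit.\<close>
  have iff: "real r * 2 powi (m - n - 1) \<le> 1 \<longleftrightarrow> m \<le> ?m" for m
  proof -
    have "real r * 2 powi (m - n - 1) = 2 powr (log 2 r + of_int (m - n - 1))"
      using assms by (simp add: two_powi_eq_powr powr_add)
    also have "\<dots> \<le> 1 \<longleftrightarrow> log 2 r + of_int (m - n - 1) \<le> 0"
      using powr_le_cancel_iff[of 2 "log 2 r + of_int (m - n - 1)" 0] by simp
    also have "\<dots> \<longleftrightarrow> m \<le> ?m" by linarith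
    finally show ?thesis .
  qed
  have "coarse_levels r n = ?m"
    unfolding coarse_levels_def iff by (rule Greatest_equality) auto
  moreover have "0 \<le> log 2 r" using assms by simp
  ultimately show ?thesis by linarith
qed

text \<open>Going \<open>k\<close> levels coarser costs a factor
  \<open>2 powr (k * \<alpha>)\<close>, while the weight gains \<open>2 powr (- k * r)\<close>. The
  net ratio \<open>2 powr (\<alpha> - r)\<close> is below 1 exactly because
  \<open>\<alpha> < r\<close>.\<close>

lemma coarse_sum_le_geometric:
  assumes "\<And>j. - 1 \<le> j \<Longrightarrow> Psi r f j \<le> C * 2 powr (- of_int j * \<alpha>)"
    and "1 \<le> r" "\<alpha> < real r" "0 \<le> C"
  shows "coarse_sum r f n \<le> C / (1 - 2 powr (\<alpha> - r)) * 2 powr (- of_int n * \<alpha>)"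
proof -
  define q :: real where "q = 2 powr (\<alpha> - r)"
  have q: "0 \<le> q" "q < 1" using assms(3) by (auto simp: q_def powr_less_one)
  let ?m = "coarse_levels r n"
  have "coarse_sum r f n \<le> (\<Sum>k\<in>{1..?m}. C * 2 powr (- of_int n * \<alpha>) * q ^ nat k)"
    unfolding coarse_sum_def
  proof (rule sum_mono)
    fix k assume k: "k \<in> {1..?m}"
    then have "Psi r f (n - k) \<le> C * 2 powr (- of_int (n - k) * \<alpha>)"
      using coarse_levels_le[OF assms(2), of n] by (intro assms(1)) auto
    then have "2 powi (- (k * int r)) * Psi r f (n - k) \<le>
        2 powi (- (k * int r)) * (C * 2 powr (- of_int (n - k) * \<alpha>))"
      by (intro mult_left_mono) auto
    also have "\<dots> = C * 2 powr (- of_int n * \<alpha>) * q ^ nat k"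
      using k by (simp add: two_powi_eq_powr q_def powr_realpow[symmetric] powr_powr
          powr_add[symmetric] algebra_simps)
    finally show "2 powi (- (k * int r)) * Psi r f (n - k) \<le>
        C * 2 powr (- of_int n * \<alpha>) * q ^ nat k" .
  qed
  also have "\<dots> = C * 2 powr (- of_int n * \<alpha>) * (\<Sum>k\<in>nat ` {1..?m}. q ^ k)"
    by (subst sum.reindex) (auto simp: sum_distrib_left inj_on_def)
  also have "\<dots> \<le> C * 2 powr (- of_int n * \<alpha>) * (\<Sum>k. q ^ k)"
    using q assms(4) by (intro mult_left_mono sum_le_suminf summable_geometric) auto
  also have "(\<Sum>k. q ^ k) = 1 / (1 - q)" using q by (intro suminf_geometric) auto
  finally show ?thesis by (simp add: q_def field_simps)
qed

subsection \<open>Differences and moduli on the cube\<close>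

lemma unit_cube_eq_cbox: "unit_cube = cbox 0 (\<chi> i. 1)"
  by (auto simp: unit_cube_def mem_box_cart)

lemma compact_unit_cube: "compact unit_cube"
  by (simp add: unit_cube_eq_cbox)

lemma convex_unit_cube: "convex unit_cube"
  by (simp add: unit_cube_eq_cbox)

text \<open>For positive \<open>r\<close> the node is the convex combination of the two end points
  with weight \<open>k / r\<close>.\<close>

lemma unit_cube_step:
  assumes "x \<in> unit_cube" "x + real r *\<^sub>R h \<in> unit_cube" "k \<le> r"
  shows "x + real k *\<^sub>R h \<in> unit_cube"
proof (cases "r = 0")
  case False
  define u where "u = real k / real r"
  have "(1 - u) *\<^sub>R x + u *\<^sub>R (x + real r *\<^sub>R h) \<in> unit_cube"
    by (rule convexD[OF convex_unit_cube]) (use assms False in \<open>auto simp: u_def divide_simps\<close>)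
  also have "(1 - u) *\<^sub>R x + u *\<^sub>R (x + real r *\<^sub>R h) = x + (u * real r) *\<^sub>R h"
    by (simp add: algebra_simps)
  finally show ?thesis using False by (simp add: u_def)
qed (use assms in auto)

text \<open>The binomial coefficients of row \<open>r\<close> add up to
  \<open>2 ^ r\<close>.\<close>

lemma fwd_diff_abs_le:
  assumes "\<And>k. k \<le> r \<Longrightarrow> \<bar>f (x + real k *\<^sub>R h)\<bar> \<le> B"
  shows "\<bar>fwd_diff r h f x\<bar> \<le> 2 ^ r * B"
proof -
  have "\<bar>fwd_diff r h f x\<bar> \<le>
      (\<Sum>k=0..r. \<bar>(-1) ^ (r - k) * real (r choose k) * f (x + real k *\<^sub>R h)\<bar>)"
    unfolding fwd_diff_def by (rule sum_abs)
  also have "\<dots> \<le> (\<Sum>k=0..r. real (r choose k) * B)"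
    using assms by (intro sum_mono) (auto simp: abs_mult power_abs intro!: mult_left_mono)
  also have "\<dots> = real (\<Sum>k\<le>r. r choose k) * B"
    by (simp add: sum_distrib_right atLeast0AtMost)
  finally show ?thesis by (simp add: choose_row_sum)
qed

text \<open>Boundedness, from compactness of the cube, is what makes the real-valued
  \<open>Sup\<close> in \<open>smooth_modulus\<close> and \<open>Psi\<close> a genuine
  supremum.\<close>

lemma fwd_diff_bounded:
  fixes f :: "real^'d \<Rightarrow> real"
  assumes "continuous_on unit_cube f"
  obtains B where "\<And>h x. x \<in> unit_cube \<Longrightarrow> x + real r *\<^sub>R h \<in> unit_cube \<Longrightarrow> \<bar>fwd_diff r h f x\<bar> \<le> B"
proof -
  have "bounded (f ` unit_cube)"
    by (intro compact_imp_bounded compact_continuous_image assms compact_unit_cube)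
  then obtain B where B: "\<And>x. x \<in> unit_cube \<Longrightarrow> \<bar>f x\<bar> \<le> B"
    by (auto simp: bounded_iff)
  show thesis
  proof (rule that)
    fix h x :: "real^'d"
    assume "x \<in> unit_cube" "x + real r *\<^sub>R h \<in> unit_cube"
    then show "\<bar>fwd_diff r h f x\<bar> \<le> 2 ^ r * B"
      using unit_cube_step by (metis B fwd_diff_abs_le)
  qed
qed

lemma smooth_modulus_upper:
  assumes "continuous_on unit_cube f" "norm h \<le> t" "x \<in> unit_cube" "x + real r *\<^sub>R h \<in> unit_cube"
  shows "\<bar>fwd_diff r h f x\<bar> \<le> smooth_modulus r f t"
proof -
  let ?S = "{\<bar>fwd_diff r h f x\<bar> |h x.
      norm h \<le> t \<and> x \<in> unit_cube \<and> x + real r *\<^sub>R h \<in> unit_cube}"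
  obtain B where B: "\<And>h x. x \<in> unit_cube \<Longrightarrow> x + real r *\<^sub>R h \<in> unit_cube \<Longrightarrow>
      \<bar>fwd_diff r h f x\<bar> \<le> B"
    using fwd_diff_bounded[OF assms(1), of r] by metis
  have "bdd_above ?S" by (rule bdd_aboveI[of _ B]) (use B in auto)
  moreover have "\<bar>fwd_diff r h f x\<bar> \<in> ?S"
    using assms(2-4) by (intro CollectI exI[of _ h] exI[of _ x]) simp
  ultimately show ?thesis unfolding smooth_modulus_def by (rule cSup_upper[rotated])
qed

lemma zero_in_unit_cube: "0 \<in> unit_cube"
  by (simp add: unit_cube_def)

lemma smooth_modulus_nonneg:
  assumes "continuous_on unit_cube f" "0 \<le> t"
  shows "0 \<le> smooth_modulus r f t"
proof -
  have "\<bar>fwd_diff r 0 f 0\<bar> \<le> smooth_modulus r f t"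
    by (rule smooth_modulus_upper[OF assms(1)]) (simp_all add: assms(2) zero_in_unit_cube)
  then show ?thesis by linarith
qed

lemma smooth_modulus_least:
  assumes "0 \<le> t" "\<And>h x. norm h \<le> t \<Longrightarrow> x \<in> unit_cube \<Longrightarrow> x + real r *\<^sub>R h \<in> unit_cube \<Longrightarrow>
      \<bar>fwd_diff r h f x\<bar> \<le> B"
  shows "smooth_modulus r f t \<le> B"
proof -
  let ?S = "{\<bar>fwd_diff r h f x\<bar> |h x.
      norm h \<le> t \<and> x \<in> unit_cube \<and> x + real r *\<^sub>R h \<in> unit_cube}"
  \<comment> \<open>The zero step at the origin shows that the set is nonempty, without which
    \<open>Sup\<close> would be unspecified.\<close>
  have mem: "\<bar>fwd_diff r 0 f 0\<bar> \<in> ?S"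
    using assms(1) by (intro CollectI exI[of _ 0] exI[of _ 0]) (simp add: zero_in_unit_cube)
  show ?thesis
    unfolding smooth_modulus_def
  proof (rule cSup_least)
    show "?S \<noteq> {}"
    proof
      assume "?S = {}"
      with mem show False by (simp only: empty_iff)
    qed
  next
    fix y assume "y \<in> ?S"
    then show "y \<le> B" using assms(2) by blast
  qed
qed

lemma grid_point_axis:
  "grid_point n (\<kappa> + axis i (int r)) = grid_point n \<kappa> + real r *\<^sub>R (2 powi (- n) *\<^sub>R axis i 1)"
  by (simp add: grid_point_def vec_eq_iff axis_def algebra_simps)

lemma Psi_upper:
  assumes "continuous_on unit_cube f" "grid_point n \<kappa> \<in> unit_cube"
    "grid_point n (\<kappa> + axis i (int r)) \<in> unit_cube"
  shows "\<bar>fwd_diff r (2 powi (- n) *\<^sub>R axis i 1) f (grid_point n \<kappa>)\<bar> \<le> Psi r f n"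
proof -
  obtain B where B: "\<And>h x. x \<in> unit_cube \<Longrightarrow> x + real r *\<^sub>R h \<in> unit_cube \<Longrightarrow>
      \<bar>fwd_diff r h f x\<bar> \<le> B"
    using fwd_diff_bounded[OF assms(1), of r] by metis
  have "bdd_above (dyadic_diffs r f n)"
    by (rule bdd_aboveI[of _ B]) (use B in \<open>auto simp: dyadic_diffs_def grid_point_axis\<close>)
  moreover have mem: "\<bar>fwd_diff r (2 powi (- n) *\<^sub>R axis i 1) f (grid_point n \<kappa>)\<bar> \<in> dyadic_diffs r f n"
    unfolding dyadic_diffs_def using assms(2,3) by (intro CollectI exI[of _ i] exI[of _ \<kappa>]) simp
  ultimately have "\<bar>fwd_diff r (2 powi (- n) *\<^sub>R axis i 1) f (grid_point n \<kappa>)\<bar> \<le>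
      Sup (dyadic_diffs r f n)"
    by (rule cSup_upper[rotated])
  moreover from mem have "dyadic_diffs r f n \<noteq> {}" by (metis empty_iff)
  ultimately show ?thesis unfolding Psi_def by (simp only: if_False)
qed

lemma Psi_nonneg:
  fixes f :: "real^'d \<Rightarrow> real"
  assumes "continuous_on unit_cube f"
  shows "0 \<le> Psi r f n"
proof (cases "dyadic_diffs r f n = {}")
  case False
  then obtain i and \<kappa> :: "int^'d"
    where "grid_point n \<kappa> \<in> unit_cube" "grid_point n (\<kappa> + axis i (int r)) \<in> unit_cube"
    unfolding dyadic_diffs_def by fastforce
  from Psi_upper[OF assms this] show ?thesis by linarith
qed (simp add: Psi_def)

text \<open>The assumption \<open>0 \<le> B\<close> covers the convention that \<open>Psi\<close> is
  0 on an empty set of differences.\<close>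

lemma Psi_least:
  assumes "0 \<le> B" "\<And>i x. x \<in> unit_cube \<Longrightarrow> x + real r *\<^sub>R (2 powi (- n) *\<^sub>R axis i 1) \<in> unit_cube \<Longrightarrow>
      \<bar>fwd_diff r (2 powi (- n) *\<^sub>R axis i 1) f x\<bar> \<le> B"
  shows "Psi r f n \<le> B"
proof (cases "dyadic_diffs r f n = {}")
  case False
  then have "Sup (dyadic_diffs r f n) \<le> B"
    by (rule cSup_least) (use assms(2) in \<open>auto simp: dyadic_diffs_def grid_point_axis\<close>)
  with False show ?thesis by (simp add: Psi_def)
qed (simp add: Psi_def assms(1))

text \<open>The factor \<open>2 powr \<alpha>\<close> pays for rounding \<open>t\<close> to a dyadic
  level, as the grid step is less than \<open>2 * t\<close>.\<close>

lemma dyadic_powr_le: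
  fixes t \<alpha> :: real
  assumes "2 powi (- n - 1) < t" "0 \<le> \<alpha>"
  shows "2 powr (- of_int n * \<alpha>) \<le> 2 powr \<alpha> * t powr \<alpha>"
proof -
  have "2 powr (- of_int n * \<alpha>) = 2 powr \<alpha> * (2 powi (- n - 1)) powr \<alpha>"
    by (simp add: two_powi_eq_powr powr_powr powr_add[symmetric] algebra_simps)
  also have "\<dots> \<le> 2 powr \<alpha> * t powr \<alpha>"
    using assms by (intro mult_left_mono powr_mono2) auto
  finally show ?thesis .
qed

text \<open>This transfers the estimates from extended nonnegative values back to the reals.
  \<open>max 0 M\<close> appears because \<open>ennreal\<close> sends a negative constant to
  0.\<close>

lemma ennreal_le_mult_bound:
  assumes "ennreal x \<le> ennreal M * y" "y \<le> ennreal z" "0 \<le> z"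
  shows "x \<le> max 0 M * z"
proof -
  have "ennreal x \<le> ennreal (max 0 M) * ennreal z"
    using assms(1) mult_left_mono[OF assms(2), of "ennreal M"] by (simp add: ennreal_max_0)
  also have "\<dots> = ennreal (max 0 M * z)"
    by (rule ennreal_mult[symmetric]) (use assms(3) in auto)
  finally show ?thesis using assms(3) by (subst (asm) ennreal_le_iff) auto
qed

section \<open>Consequences of the estimates (A) and (B)\<close>

lemma axis_diff_bound_of_estimate_A:
  fixes f :: "real^'d \<Rightarrow> real"
  assumes "0 < \<alpha>" "Psi r f \<in> O[at_top](\<lambda>n. 2 powr (- of_int n * \<alpha>))" "estimate_A M r f"
  shows "\<exists>C. \<forall>\<^sub>F t in at_right 0. \<forall>i x.
           x \<in> unit_cube \<and> x + (real r * t) *\<^sub>R axis i 1 \<in> unit_cube \<longrightarrow>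
           \<bar>fwd_diff r (t *\<^sub>R axis i 1) f x\<bar> \<le> C * t powr \<alpha>"
proof -
  obtain c where c: "0 \<le> c" "\<And>j. 0 \<le> j \<Longrightarrow> \<bar>Psi r f j\<bar> \<le> c * 2 powr (- of_int j * \<alpha>)"
    using Psi_bigo_bound[OF assms(2), of 0] by blast
  define D where "D = c / (1 - 2 powr - \<alpha>)"
  have D: "0 \<le> D" using c(1) assms(1) by (simp add: D_def powr_less_one less_imp_le)
  let ?C = "max 0 M * (D * 2 powr \<alpha>)"
  have "\<forall>\<^sub>F t in at_right (0::real). t \<in> {0<..<1}"
    by (rule eventually_at_right_real) simp
  then have "\<forall>\<^sub>F t in at_right 0. \<forall>i x.
           x \<in> unit_cube \<and> x + (real r * t) *\<^sub>R axis i 1 \<in> unit_cube \<longrightarrow>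
           \<bar>fwd_diff r (t *\<^sub>R axis i 1) f x\<bar> \<le> ?C * t powr \<alpha>"
  proof (eventually_elim, intro allI impI)
    fix t :: real and i :: 'd and x
    assume t: "t \<in> {0<..<1}" and
      x: "x \<in> unit_cube \<and> x + (real r * t) *\<^sub>R axis i 1 \<in> unit_cube"
    obtain n where n: "2 powi (- n - 1) < t" "t \<le> 2 powi (- n)" "n = \<lfloor>- log 2 t\<rfloor>"
      using dyadic_scale[of t] t by auto
    \<comment> \<open>With \<open>n\<close> nonnegative, the bound \<open>c\<close>, valid from
      level 0 on, covers the whole tail.\<close>
    have "0 \<le> n" using t n(3) by (simp add: less_imp_le)
    then have "Psi_tail r f n \<le> ennreal (D * 2 powr (- of_int n * \<alpha>))"
      unfolding D_def by (intro Psi_tail_le_geometric order_trans[OF abs_ge_self c(2)] assms c) auto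
    moreover have "ennreal \<bar>fwd_diff r (t *\<^sub>R axis i 1) f x\<bar> \<le> ennreal M * Psi_tail r f n"
      using assms(3) x t n(2) unfolding estimate_A_def by simp
    ultimately have "\<bar>fwd_diff r (t *\<^sub>R axis i 1) f x\<bar> \<le> max 0 M * (D * 2 powr (- of_int n * \<alpha>))"
      using D by (intro ennreal_le_mult_bound) auto
    also have "\<dots> \<le> max 0 M * (D * (2 powr \<alpha> * t powr \<alpha>))"
      using D dyadic_powr_le[OF n(1)] assms(1) by (intro mult_left_mono) auto
    finally show "\<bar>fwd_diff r (t *\<^sub>R axis i 1) f x\<bar> \<le> ?C * t powr \<alpha>" by (simp add: mult_ac)
  qed
  then show ?thesis by blast
qed

lemma smooth_modulus_bigo_of_estimate_B:
  fixes f :: "real^'d \<Rightarrow> real"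
  assumes "continuous_on unit_cube f" "1 \<le> r" "0 < \<alpha>" "\<alpha> < real r"
    "Psi r f \<in> O[at_top](\<lambda>n. 2 powr (- of_int n * \<alpha>))" "estimate_B M r f"
  shows "smooth_modulus r f \<in> O[at_right 0](\<lambda>t. t powr \<alpha>)"
proof -
  \<comment> \<open>The coarsest level that can occur in \<open>coarse_sum\<close> is -1.\<close>
  obtain c where c: "0 \<le> c" "\<And>j. - 1 \<le> j \<Longrightarrow> \<bar>Psi r f j\<bar> \<le> c * 2 powr (- of_int j * \<alpha>)"
    using Psi_bigo_bound[OF assms(5), of "- 1"] by blast
  have c': "Psi r f j \<le> c * 2 powr (- of_int j * \<alpha>)" if "- 1 \<le> j" for j
    using c(2)[OF that] by linarith
  define D where "D = c / (1 - 2 powr - \<alpha>)"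
  define E where "E = c / (1 - 2 powr (\<alpha> - r))"
  define N where "N = max 0 (cube_norm f)"
  have "2 powr - \<alpha> < (1::real)" "2 powr (\<alpha> - r) < (1::real)"
    using assms by (auto intro!: powr_less_one)
  then have DE: "0 \<le> D" "0 \<le> E" using c(1) by (auto simp: D_def E_def)
  have N: "0 \<le> N" "cube_norm f \<le> N" by (auto simp: N_def)
  let ?C = "max 0 M * ((D + E) * 2 powr \<alpha> + N)"
  have "\<forall>\<^sub>F t in at_right (0::real). t \<in> {0<..<1}"
    by (rule eventually_at_right_real) simp
  then have "\<forall>\<^sub>F t in at_right 0. norm (smooth_modulus r f t) \<le> ?C * norm (t powr \<alpha>)"
  proof eventually_elim
    fix t :: real
    assume t: "t \<in> {0<..<1}"
    obtain n where n: "2 powi (- n - 1) < t" "t \<le> 2 powi (- n)" "n = \<lfloor>- log 2 t\<rfloor>"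
      using dyadic_scale[of t] t by auto
    have "0 \<le> n" using t n(3) by (simp add: less_imp_le)
    define y where "y = 2 powr (- of_int n * \<alpha>)"
    have y: "0 \<le> y" "y \<le> 2 powr \<alpha> * t powr \<alpha>"
      using dyadic_powr_le[OF n(1)] assms(3) by (auto simp: y_def)
    \<comment> \<open>Since \<open>t < 1\<close> and \<open>\<alpha> < r\<close>, the norm term is
      also of order \<open>t powr \<alpha>\<close>.\<close>
    have "t ^ r = t powr r" using t by (simp add: powr_realpow)
    also have "\<dots> \<le> t powr \<alpha>" using t assms(4) by (intro powr_mono') auto
    finally have tr: "t ^ r \<le> t powr \<alpha>" .
    have "Psi_tail r f n \<le> ennreal (D * y)"
      unfolding D_def y_def using \<open>0 \<le> n\<close>
      by (intro Psi_tail_le_geometric c' assms c) auto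
    moreover have "ennreal (coarse_sum r f n) \<le> ennreal (E * y)"
      unfolding E_def y_def by (intro ennreal_leI coarse_sum_le_geometric c' assms c)
    moreover have "ennreal (t ^ r * cube_norm f) \<le> ennreal (t powr \<alpha> * N)"
      using t N tr by (intro ennreal_leI order_trans[OF mult_left_mono mult_right_mono]) auto
    ultimately have "Psi_tail r f n + ennreal (coarse_sum r f n) + ennreal (t ^ r * cube_norm f) \<le>
        ennreal (D * y) + ennreal (E * y) + ennreal (t powr \<alpha> * N)"
      by (intro add_mono)
    also have "\<dots> = ennreal (D * y + E * y + t powr \<alpha> * N)"
      using DE N y by simp
    finally have le: "Psi_tail r f n + ennreal (coarse_sum r f n) + ennreal (t ^ r * cube_norm f) \<le>
        ennreal (D * y + E * y + t powr \<alpha> * N)" .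
    have "smooth_modulus r f t \<le> max 0 M * (D * y + E * y + t powr \<alpha> * N)"
    proof (rule ennreal_le_mult_bound[OF _ le])
      show "ennreal (smooth_modulus r f t) \<le>
          ennreal M * (Psi_tail r f n + ennreal (coarse_sum r f n) + ennreal (t ^ r * cube_norm f))"
        using assms(6) n unfolding estimate_B_def by blast
    qed (use DE N y in auto)
    also have "\<dots> \<le> max 0 M *
        (D * (2 powr \<alpha> * t powr \<alpha>) + E * (2 powr \<alpha> * t powr \<alpha>) + t powr \<alpha> * N)"
      using DE y by (intro mult_left_mono add_mono) auto
    finally have "smooth_modulus r f t \<le> ?C * t powr \<alpha>"
      by (simp add: algebra_simps)
    then show "norm (smooth_modulus r f t) \<le> ?C * norm (t powr \<alpha>)"
      using smooth_modulus_nonneg[OF assms(1), of t r] t by simp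
  qed
  then show ?thesis by (rule bigoI)
qed

subsection \<open>Dyadic chaining for first differences\<close>

lemma grid_point_in_unit_cube_iff:
  "grid_point n \<kappa> \<in> unit_cube \<longleftrightarrow>
    (\<forall>j. 0 \<le> 2 powi (- n) * real_of_int (\<kappa> $ j) \<and> 2 powi (- n) * real_of_int (\<kappa> $ j) \<le> 1)"
  by (simp add: grid_point_def unit_cube_def)

text \<open>Replace the coordinates of \<open>\<kappa>\<close> by those of \<open>\<mu>\<close> one
  at a time. Each replacement is a move of at most one grid step along an axis and costs at most
  \<open>Psi 1 f n\<close>.\<close>

lemma grid_neighbours_diff_le:
  fixes f :: "real^'d \<Rightarrow> real"
  assumes f: "continuous_on unit_cube f"
    and in_cube: "grid_point n \<kappa> \<in> unit_cube" "grid_point n \<mu> \<in> unit_cube"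
    and near: "\<And>j. \<bar>\<kappa> $ j - \<mu> $ j\<bar> \<le> 1"
  shows "\<bar>f (grid_point n \<mu>) - f (grid_point n \<kappa>)\<bar> \<le> real CARD('d) * Psi 1 f n"
proof -
  define mix :: "'d set \<Rightarrow> int^'d" where "mix A = (\<chi> j. if j \<in> A then \<mu> $ j else \<kappa> $ j)" for A
  \<comment> \<open>Membership in the cube is checked coordinatewise, so mixing two points of the
    cube stays inside.\<close>
  have mix_in: "grid_point n (mix A) \<in> unit_cube" for A
    using in_cube by (auto simp: mix_def grid_point_in_unit_cube_iff)
  have step: "\<bar>f (grid_point n (\<nu> + axis i 1)) - f (grid_point n \<nu>)\<bar> \<le> Psi 1 f n"
    if "grid_point n \<nu> \<in> unit_cube" "grid_point n (\<nu> + axis i 1) \<in> unit_cube" for \<nu> i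
    using Psi_upper[of f n \<nu> i 1] that f grid_point_axis[of n \<nu> i 1] by (simp add: fwd_diff_def)
  have "\<bar>f (grid_point n (mix A)) - f (grid_point n \<kappa>)\<bar> \<le> real (card A) * Psi 1 f n" for A
  proof (induction A rule: finite_induct[OF finite])
    case 1
    have "mix {} = \<kappa>" by (simp add: mix_def vec_eq_iff)
    then show ?case by simp
  next
    case (2 a A)
    have ins: "mix (insert a A) = mix A + axis a (\<mu> $ a - \<kappa> $ a)"
      using 2 by (auto simp: mix_def vec_eq_iff axis_def)
    consider "\<mu> $ a - \<kappa> $ a = 0" | "\<mu> $ a - \<kappa> $ a = 1" | "\<mu> $ a - \<kappa> $ a = - 1"
      using near[of a] by linarith
    then have "\<bar>f (grid_point n (mix (insert a A))) - f (grid_point n (mix A))\<bar> \<le> Psi 1 f n"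
    proof cases
      case 1
      then show ?thesis using ins Psi_nonneg[OF f] by (simp add: axis_def zero_vec_def[symmetric])
    next
      case 2
      then show ?thesis using step[of "mix A" a] mix_in[of A] mix_in[of "insert a A"] ins by simp
    next
      case 3
      \<comment> \<open>A step of -1 is the forward step taken from the new point back to the old
        one.\<close>
      have "mix A = mix (insert a A) + axis a 1"
        unfolding ins 3 by (simp add: vec_eq_iff axis_def)
      then show ?thesis
        using step[of "mix (insert a A)" a] mix_in[of A] mix_in[of "insert a A"]
        by (simp add: abs_minus_commute)
    qed
    moreover have "real (card (insert a A)) * Psi 1 f n = real (card A) * Psi 1 f n + Psi 1 f n"
      using 2 by (simp add: algebra_simps)
    ultimately show ?case using 2 by linarith
  qed
  from this[of UNIV] show ?thesis by (simp add: mix_def)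
qed

text \<open>Rounding down keeps the resulting grid point inside the cube at every level.\<close>

definition floor_index :: "int \<Rightarrow> real^'d \<Rightarrow> int^'d" where
  "floor_index n x = (\<chi> j. \<lfloor>2 powi n * x $ j\<rfloor>)"

lemma grid_floor_in_unit_cube:
  assumes "x \<in> unit_cube"
  shows "grid_point n (floor_index n x) \<in> unit_cube"
  unfolding grid_point_in_unit_cube_iff
proof
  fix j
  have x: "0 \<le> x $ j" "x $ j \<le> 1" using assms by (auto simp: unit_cube_def)
  have "of_int \<lfloor>2 powi n * x $ j\<rfloor> \<le> 2 powi n * x $ j" by simp
  also have "\<dots> \<le> 2 powi n" using x by (simp add: mult_left_le)
  finally show "0 \<le> 2 powi (- n) * real_of_int (floor_index n x $ j) \<and>
      2 powi (- n) * real_of_int (floor_index n x $ j) \<le> 1"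
    using x by (simp add: floor_index_def power_int_minus field_simps)
qed

lemma grid_floor_tendsto: "(\<lambda>m. grid_point (n + int m) (floor_index (n + int m) x)) \<longlonglongrightarrow> x"
proof (rule vec_tendstoI)
  fix j
  have "(\<lambda>m. (1/2) ^ m) \<longlonglongrightarrow> (0::real)" by (rule LIMSEQ_realpow_zero) auto
  then have lim: "(\<lambda>m. 2 powi (- n) * (1/2) ^ m) \<longlonglongrightarrow> (0::real)"
    by (rule tendsto_mult_right_zero)
  show "(\<lambda>m. grid_point (n + int m) (floor_index (n + int m) x) $ j) \<longlonglongrightarrow> x $ j"
  proof (rule LIM_zero_cancel, rule Lim_null_comparison[OF _ lim], rule always_eventually, rule allI)
    fix m
    let ?p = "2 powi (n + int m) :: real"
    have "\<bar>of_int \<lfloor>?p * x $ j\<rfloor> - ?p * x $ j\<bar> \<le> 1" by linarith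
    then have "2 powi (- (n + int m)) * \<bar>of_int \<lfloor>?p * x $ j\<rfloor> - ?p * x $ j\<bar> \<le> 2 powi (- (n + int m))"
      by (simp add: mult_left_le)
    also have "2 powi (- (n + int m)) = (2 powi (- n) * (1/2) ^ m :: real)"
      by (simp add: power_int_diff power_one_over field_simps)
    also have "2 powi (- (n + int m)) * \<bar>of_int \<lfloor>?p * x $ j\<rfloor> - ?p * x $ j\<bar> =
        \<bar>2 powi (- (n + int m)) * (of_int \<lfloor>?p * x $ j\<rfloor> - ?p * x $ j)\<bar>"
      by (simp add: abs_mult)
    also have "2 powi (- (n + int m)) * (of_int \<lfloor>?p * x $ j\<rfloor> - ?p * x $ j) =
        grid_point (n + int m) (floor_index (n + int m) x) $ j - x $ j"
      unfolding grid_point_def floor_index_def power_int_minus by (simp add: field_simps)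
    finally show "norm (grid_point (n + int m) (floor_index (n + int m) x) $ j - x $ j) \<le>
        2 powi (- n) * (1/2) ^ m" by simp
  qed
qed

text \<open>The level \<open>n\<close> rounding is also a grid point of level \<open>n + 1\<close>,
  with doubled indices. Twice a floor and the floor of the double differ by at most 1, so the two
  roundings are neighbours on the finer grid.\<close>

lemma grid_floor_refine_diff_le:
  fixes f :: "real^'d \<Rightarrow> real"
  assumes "continuous_on unit_cube f" "x \<in> unit_cube"
  shows "\<bar>f (grid_point (n + 1) (floor_index (n + 1) x)) - f (grid_point n (floor_index n x))\<bar> \<le>
    real CARD('d) * Psi 1 f (n + 1)"
proof -
  have eq: "grid_point n (floor_index n x) = grid_point (n + 1) (\<chi> j. 2 * floor_index n x $ j)"
    using power_int_add[of "2::real" 1 "- (n + 1)"] by (simp add: grid_point_def vec_eq_iff)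
  show ?thesis
    unfolding eq
  proof (rule grid_neighbours_diff_le[OF assms(1)])
    show "grid_point (n + 1) (\<chi> j. 2 * floor_index n x $ j) \<in> unit_cube"
      using grid_floor_in_unit_cube[OF assms(2), of n] unfolding eq .
    show "grid_point (n + 1) (floor_index (n + 1) x) \<in> unit_cube"
      by (rule grid_floor_in_unit_cube[OF assms(2)])
    fix j
    have "\<bar>2 * \<lfloor>y\<rfloor> - \<lfloor>2 * y\<rfloor>\<bar> \<le> 1" for y :: real by linarith
    from this[of "2 powi n * x $ j"]
    show "\<bar>(\<chi> j. 2 * floor_index n x $ j) $ j - floor_index (n + 1) x $ j\<bar> \<le> 1"
      by (simp add: floor_index_def power_int_add mult_ac)
  qed
qed

text \<open>Telescope over successive roundings, whose differences decay geometrically. The bound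
  does not depend on the number of levels, so it survives the limit, where continuity turns the
  roundings into \<open>x\<close>.\<close>

lemma grid_floor_diff_le:
  fixes f :: "real^'d \<Rightarrow> real"
  assumes f: "continuous_on unit_cube f" and x: "x \<in> unit_cube" and "0 < \<alpha>" "0 \<le> C"
    and Psi: "\<And>j. n \<le> j \<Longrightarrow> Psi 1 f j \<le> C * 2 powr (- of_int j * \<alpha>)"
  shows "\<bar>f x - f (grid_point n (floor_index n x))\<bar> \<le>
    real CARD('d) * C / (1 - 2 powr - \<alpha>) * 2 powr (- of_int n * \<alpha>)" (is "_ \<le> ?K")
proof -
  define q :: real where "q = 2 powr - \<alpha>"
  have q: "0 \<le> q" "q < 1" using \<open>0 < \<alpha>\<close> by (auto simp: q_def powr_less_one)
  define a where "a m = f (grid_point (n + int m) (floor_index (n + int m) x))" for m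
  define b where "b = real CARD('d) * C * 2 powr (- of_int n * \<alpha>)"
  have b: "0 \<le> b" using \<open>0 \<le> C\<close> by (simp add: b_def)
  have step: "\<bar>a (Suc m) - a m\<bar> \<le> b * q ^ m" for m
  proof -
    have "\<bar>a (Suc m) - a m\<bar> \<le> real CARD('d) * Psi 1 f (n + int m + 1)"
      using grid_floor_refine_diff_le[OF f x, of "n + int m"] by (simp add: a_def algebra_simps)
    also have "\<dots> \<le> real CARD('d) * (C * 2 powr (- of_int (n + int m + 1) * \<alpha>))"
      by (intro mult_left_mono Psi) auto
    \<comment> \<open>Giving up the gain of one level keeps the geometric constant simple.\<close>
    also have "\<dots> \<le> real CARD('d) * (C * 2 powr (- of_int (n + int m) * \<alpha>))"
      using \<open>0 < \<alpha>\<close> \<open>0 \<le> C\<close> by (intro mult_left_mono powr_mono) (auto simp: algebra_simps)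
    also have "2 powr (- of_int (n + int m) * \<alpha>) = 2 powr (- of_int n * \<alpha>) * q ^ m"
      by (simp add: q_def powr_add[symmetric] powr_realpow[symmetric] powr_powr algebra_simps)
    finally show ?thesis by (simp add: b_def mult_ac)
  qed
  have sum: "\<bar>a m - a 0\<bar> \<le> b * (\<Sum>k<m. q ^ k)" for m
  proof (induction m)
    case (Suc m)
    then show ?case using step[of m] by (simp add: algebra_simps)
  qed simp
  have bound: "\<bar>a m - a 0\<bar> \<le> ?K" for m
  proof -
    have "(\<Sum>k<m. q ^ k) \<le> (\<Sum>k. q ^ k)"
      using q by (intro sum_le_suminf summable_geometric) auto
    also have "\<dots> = 1 / (1 - q)" using q by (intro suminf_geometric) auto
    finally have "b * (\<Sum>k<m. q ^ k) \<le> b * (1 / (1 - q))" using b by (rule mult_left_mono)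
    with sum[of m] show ?thesis by (simp add: b_def q_def)
  qed
  have "a \<longlonglongrightarrow> f x"
    unfolding a_def using f x grid_floor_in_unit_cube[OF x] grid_floor_tendsto
    by (intro continuous_on_tendsto_compose[OF f]) auto
  then have "(\<lambda>m. \<bar>a m - a 0\<bar>) \<longlonglongrightarrow> \<bar>f x - a 0\<bar>" by (intro tendsto_intros)
  then have "\<bar>f x - a 0\<bar> \<le> ?K" by (rule LIMSEQ_le_const2) (use bound in auto)
  then show ?thesis by (simp add: a_def)
qed

text \<open>Compare \<open>x\<close> and \<open>x + h\<close> with their roundings at the level
  whose grid step is at least \<open>t\<close>. Each coordinate moves by at most one grid step, so
  the two roundings are neighbours.\<close>

lemma modulus_of_continuity_bigo:
  fixes f :: "real^'d \<Rightarrow> real"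
  assumes f: "continuous_on unit_cube f" and "0 < \<alpha>"
    and O: "Psi 1 f \<in> O[at_top](\<lambda>n. 2 powr (- of_int n * \<alpha>))"
  shows "smooth_modulus 1 f \<in> O[at_right 0](\<lambda>t. t powr \<alpha>)"
proof -
  obtain c where c: "0 \<le> c" "\<And>j. 0 \<le> j \<Longrightarrow> \<bar>Psi 1 f j\<bar> \<le> c * 2 powr (- of_int j * \<alpha>)"
    using Psi_bigo_bound[OF O, of 0] by blast
  have c': "Psi 1 f j \<le> c * 2 powr (- of_int j * \<alpha>)" if "0 \<le> j" for j
    using c(2)[OF that] by linarith
  define K where "K = real CARD('d) * c / (1 - 2 powr - \<alpha>)"
  have "2 powr - \<alpha> < (1::real)" using \<open>0 < \<alpha>\<close> by (auto intro!: powr_less_one)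
  then have K: "0 \<le> K" using c(1) by (auto simp: K_def)
  let ?C = "(2 * K + real CARD('d) * c) * 2 powr \<alpha>"
  have "\<forall>\<^sub>F t in at_right (0::real). t \<in> {0<..<1}"
    by (rule eventually_at_right_real) simp
  then have "\<forall>\<^sub>F t in at_right 0. norm (smooth_modulus 1 f t) \<le> ?C * norm (t powr \<alpha>)"
  proof eventually_elim
    fix t :: real
    assume t: "t \<in> {0<..<1}"
    obtain n where n: "2 powi (- n - 1) < t" "t \<le> 2 powi (- n)" "n = \<lfloor>- log 2 t\<rfloor>"
      using dyadic_scale[of t] t by auto
    have "0 \<le> n" using t n(3) by (simp add: less_imp_le)
    define y where "y = 2 powr (- of_int n * \<alpha>)"
    have "smooth_modulus 1 f t \<le> (2 * K + real CARD('d) * c) * y"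
    proof (rule smooth_modulus_least)
      fix h x :: "real^'d"
      assume h: "norm h \<le> t" and x: "x \<in> unit_cube" and "x + real 1 *\<^sub>R h \<in> unit_cube"
      then have xh: "x + h \<in> unit_cube" by simp
      let ?g = "\<lambda>z. f (grid_point n (floor_index n z))"
      have approx: "\<bar>f z - ?g z\<bar> \<le> K * y" if "z \<in> unit_cube" for z
        unfolding K_def y_def
        by (rule grid_floor_diff_le[OF f that]) (use \<open>0 < \<alpha>\<close> \<open>0 \<le> n\<close> c c' in auto)
      have "\<bar>?g (x + h) - ?g x\<bar> \<le> real CARD('d) * Psi 1 f n"
      proof (rule grid_neighbours_diff_le[OF f])
        fix j
        have "\<bar>h $ j\<bar> \<le> 2 powi (- n)"
          using component_le_norm_cart[of h j] h n(2) by linarith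
        then have "\<bar>2 powi n * h $ j\<bar> \<le> 1"
          by (simp add: abs_mult power_int_minus field_simps)
        then have "\<bar>\<lfloor>2 powi n * x $ j\<rfloor> - \<lfloor>2 powi n * x $ j + 2 powi n * h $ j\<rfloor>\<bar> \<le> 1"
          by linarith
        then show "\<bar>floor_index n x $ j - floor_index n (x + h) $ j\<bar> \<le> 1"
          by (simp add: floor_index_def algebra_simps)
      qed (intro grid_floor_in_unit_cube x xh)+
      also have "\<dots> \<le> real CARD('d) * (c * y)"
        unfolding y_def using \<open>0 \<le> n\<close> by (intro mult_left_mono c') auto
      finally have "\<bar>f (x + h) - f x\<bar> \<le> K * y + K * y + real CARD('d) * (c * y)"
        using approx[OF x] approx[OF xh] by linarith
      then show "\<bar>fwd_diff 1 h f x\<bar> \<le> (2 * K + real CARD('d) * c) * y"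
        by (simp add: fwd_diff_def algebra_simps)
    qed (use t in auto)
    also have "\<dots> \<le> (2 * K + real CARD('d) * c) * (2 powr \<alpha> * t powr \<alpha>)"
      unfolding y_def using K c(1) \<open>0 < \<alpha>\<close> by (intro mult_left_mono dyadic_powr_le n) auto
    finally show "norm (smooth_modulus 1 f t) \<le> ?C * norm (t powr \<alpha>)"
      using smooth_modulus_nonneg[OF f, of t 1] t by (simp add: mult_ac)
  qed
  then show ?thesis by (rule bigoI)
qed

subsection \<open>Differences of logarithmic forms along a segment\<close>

text \<open>Pascal's rule: a difference of order \<open>r + 1\<close> is the difference of order
  \<open>r\<close> of the first differences.\<close>

lemma alternating_binomial_sum_Suc:
  fixes F :: "nat \<Rightarrow> real"
  shows "(\<Sum>k=0..Suc r. (-1) ^ (Suc r - k) * real (Suc r choose k) * F k) =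
    (\<Sum>k=0..r. (-1) ^ (r - k) * real (r choose k) * (F (Suc k) - F k))"
proof -
  let ?c = "\<lambda>k. (-1) ^ (Suc r - k) :: real"
  have "(\<Sum>k=0..Suc r. ?c k * real (Suc r choose k) * F k) =
      ?c 0 * F 0 + (\<Sum>k=0..r. ?c (Suc k) * real (r choose k) * F (Suc k) +
        ?c (Suc k) * real (r choose Suc k) * F (Suc k))"
    by (subst sum.atLeast0_atMost_Suc_shift) (simp add: algebra_simps)
  also have "\<dots> = (\<Sum>k=0..r. ?c (Suc k) * real (r choose k) * F (Suc k)) +
      (\<Sum>k=0..Suc r. ?c k * real (r choose k) * F k)"
    using sum.atLeast0_atMost_Suc_shift[of "\<lambda>k. ?c k * real (r choose k) * F k" r]
    by (simp add: sum.distrib del: sum.atLeast0_atMost_Suc)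
  \<comment> \<open>The top term vanishes because \<open>r choose Suc r\<close> is 0, and lowering
    the exponent flips the sign.\<close>
  also have "(\<Sum>k=0..Suc r. ?c k * real (r choose k) * F k) =
      - (\<Sum>k=0..r. (-1) ^ (r - k) * real (r choose k) * F k)"
    by (simp add: sum_negf[symmetric] Suc_diff_le binomial_eq_0)
  finally show ?thesis by (simp add: sum_subtractf right_diff_distrib)
qed

text \<open>\<open>D j\<close> plays the role of the \<open>j\<close>-th derivative of
  \<open>D 0\<close>. Apply the induction hypothesis to the unit-step first differences
  \<open>E j\<close>, then the mean value theorem between \<xi> and \<xi> + 1.\<close>

lemma difference_mean_value:
  fixes D :: "nat \<Rightarrow> real \<Rightarrow> real"
  assumes "\<And>j \<tau>. j < r \<Longrightarrow> 0 \<le> \<tau> \<Longrightarrow> \<tau> \<le> real r \<Longrightarrow> (D j has_real_derivative D (Suc j) \<tau>) (at \<tau>)"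
  shows "\<exists>\<xi>\<in>{0..real r}. (\<Sum>k=0..r. (-1) ^ (r - k) * real (r choose k) * D 0 (real k)) = D r \<xi>"
  using assms
proof (induction r arbitrary: D)
  case 0
  show ?case by (intro bexI[of _ 0]) simp_all
next
  case (Suc r)
  define E where "E j \<tau> = D j (\<tau> + 1) - D j \<tau>" for j \<tau>
  have der: "(E j has_real_derivative E (Suc j) \<tau>) (at \<tau>)" if "j < r" "0 \<le> \<tau>" "\<tau> \<le> real r" for j \<tau>
  proof -
    have "((\<lambda>\<tau>. D j (\<tau> + 1)) has_real_derivative D (Suc j) (\<tau> + 1)) (at \<tau>)"
      using Suc.prems[of j "\<tau> + 1"] that by (simp add: DERIV_shift)
    then show ?thesis
      unfolding E_def using Suc.prems[of j \<tau>] that by (intro DERIV_diff) auto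
  qed
  have "\<exists>\<xi>\<in>{0..real r}.
      (\<Sum>k=0..r. (-1) ^ (r - k) * real (r choose k) * E 0 (real k)) = E r \<xi>"
    by (rule Suc.IH[of E]) (rule der)
  then obtain \<xi> where \<xi>: "\<xi> \<in> {0..real r}"
    "(\<Sum>k=0..r. (-1) ^ (r - k) * real (r choose k) * E 0 (real k)) = E r \<xi>"
    by (elim bexE)
  have "\<exists>\<eta>. \<xi> < \<eta> \<and> \<eta> < \<xi> + 1 \<and> D r (\<xi> + 1) - D r \<xi> = (\<xi> + 1 - \<xi>) * D (Suc r) \<eta>"
    using \<xi>(1) by (intro MVT2 Suc.prems) auto
  then obtain \<eta> where \<eta>: "\<xi> < \<eta>" "\<eta> < \<xi> + 1" "E r \<xi> = D (Suc r) \<eta>"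
    by (auto simp: E_def)
  have "(\<Sum>k=0..Suc r. (-1) ^ (Suc r - k) * real (Suc r choose k) * D 0 (real k)) =
      (\<Sum>k=0..r. (-1) ^ (r - k) * real (r choose k) * (D 0 (real (Suc k)) - D 0 (real k)))"
    by (rule alternating_binomial_sum_Suc)
  also have "\<dots> = (\<Sum>k=0..r. (-1) ^ (r - k) * real (r choose k) * E 0 (real k))"
    by (simp add: E_def add.commute)
  finally show ?case using \<xi> \<eta> by (intro bexI[of _ \<eta>]) simp_all
qed

lemma higher_deriv_poly: "(deriv ^^ n) (poly P) = poly ((pderiv ^^ n) (P :: complex poly))"
proof (induction n)
  case (Suc n)
  have "deriv (poly Q) = poly (pderiv Q)" for Q :: "complex poly"
    by (rule ext) (rule DERIV_imp_deriv[OF poly_DERIV])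
  with Suc show ?case by simp
qed simp

text \<open>Degree and top coefficient together determine the derivative of order
  \<open>m + 1\<close>, a constant.\<close>

lemma coeff_linear_factor_power:
  fixes x p :: complex
  shows "coeff ([:x, p:] ^ m * [:y, q:]) (Suc m) = p ^ m * q"
    and "degree ([:x, p:] ^ m * [:y, q:]) \<le> Suc m"
proof -
  have deg: "degree ([:x, p:] ^ m) \<le> m" for m
    using degree_power_le[of "[:x, p:]" m] by (rule order_trans) simp
  have top: "coeff ([:x, p:] ^ m) m = p ^ m" for m
  proof (induction m)
    case (Suc m)
    have "coeff ([:x, p:] ^ m) (Suc m) = 0" using deg[of m] by (intro coeff_eq_0) simp
    with Suc show ?case by simp
  qed simp
  have "coeff ([:x, p:] ^ m) (Suc m) = 0" using deg[of m] by (intro coeff_eq_0) simp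
  then show "coeff ([:x, p:] ^ m * [:y, q:]) (Suc m) = p ^ m * q"
    using top[of m] by (simp add: mult.commute[of _ "[:y, q:]"])
  show "degree ([:x, p:] ^ m * [:y, q:]) \<le> Suc m"
    using degree_mult_le[of "[:x, p:] ^ m" "[:y, q:]"] deg[of m] by (auto intro: order_trans)
qed

context
  fixes x y p q :: real and m :: nat
begin

text \<open>The function \<open>x ^ m * y * ln (x + y)\<close> along the segment from
  \<open>(x, y)\<close> in direction \<open>(p, q)\<close>, with a complex parameter so that
  Cauchy's inequality can bound its derivatives.\<close>

definition log_form :: "complex \<Rightarrow> complex" where
  "log_form z = (of_real x + z * of_real p) ^ m * (of_real y + z * of_real q) *
     Ln (of_real (x + y) + z * of_real (p + q))"

text \<open>A positive real part keeps the argument of \<open>Ln\<close> off the branch cut.\<close>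

definition log_dom :: "complex set" where
  "log_dom = {z. 0 < Re (of_real (x + y) + z * of_real (p + q))}"

lemma open_log_dom: "open log_dom"
  unfolding log_dom_def by (intro open_Collect_less continuous_intros)

lemma Ln_holomorphic_log_dom:
  "(\<lambda>z. Ln (of_real (x + y) + z * of_real (p + q))) holomorphic_on log_dom"
  by (intro holomorphic_intros) (auto simp: log_dom_def complex_nonpos_Reals_iff)

lemma log_form_holomorphic: "log_form holomorphic_on log_dom"
  unfolding log_form_def[abs_def]
  by (intro holomorphic_on_mult Ln_holomorphic_log_dom holomorphic_intros)

lemma log_form_of_real:
  assumes "0 < x + y + \<tau> * (p + q)"
  shows "log_form (of_real \<tau>) = of_real ((x + \<tau> * p) ^ m * (y + \<tau> * q) * ln (x + y + \<tau> * (p + q)))"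
proof -
  have "Ln (of_real (x + y + \<tau> * (p + q))) = of_real (ln (x + y + \<tau> * (p + q)))"
    using assms by (rule Ln_of_real)
  then show ?thesis by (simp add: log_form_def)
qed

text \<open>With \<open>S\<close> the value of \<open>x + y + \<tau> (p + q)\<close>, the branch splits as \<open>ln S + Ln (1 + u)\<close>: the
  first summand contributes the top derivative of a polynomial of degree \<open>m + 1\<close>, and the
  second is controlled by Cauchy's inequality on a circle of radius comparable to \<open>S / t\<close>.\<close>

lemma log_form_higher_deriv:
  assumes t: "0 < t" "\<bar>p\<bar> \<le> t" "\<bar>q\<bar> \<le> t"
    and nonneg: "0 \<le> x + \<tau> * p" "0 \<le> y + \<tau> * q" and pos: "0 < x + y + \<tau> * (p + q)"
  shows "norm ((deriv ^^ Suc m) log_form (of_real \<tau>) -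
      of_real (fact (Suc m) * p ^ m * q * ln (x + y + \<tau> * (p + q)))) \<le> fact (Suc m) * (16 * t) ^ Suc m"
proof -
  define S where "S = x + y + \<tau> * (p + q)"
  have S: "0 < S" using pos by (simp add: S_def)
  define P where "P = [:complex_of_real x, of_real p:] ^ m * [:of_real y, of_real q:]"
  have poly_P: "poly P z = (of_real x + z * of_real p) ^ m * (of_real y + z * of_real q)" for z
    by (simp add: P_def algebra_simps)
  \<comment> \<open>Subtracting \<open>ln S\<close> normalises the logarithm to vanish at \<tau>, so
    that it is bounded near \<tau> independently of \<open>S\<close>.\<close>
  define H where "H z = poly P z * (Ln (of_real (x + y) + z * of_real (p + q)) - of_real (ln S))" for z
  have H_hol: "H holomorphic_on log_dom"
    unfolding H_def[abs_def] by (intro holomorphic_intros Ln_holomorphic_log_dom)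
  have \<tau>_in: "of_real \<tau> \<in> log_dom" using pos by (simp add: log_dom_def)
  have "(deriv ^^ Suc m) log_form (of_real \<tau>) =
      (deriv ^^ Suc m) (\<lambda>z. of_real (ln S) * poly P z + H z) (of_real \<tau>)"
    by (rule arg_cong[of _ _ "\<lambda>f. (deriv ^^ Suc m) f (of_real \<tau>)"])
      (auto simp: log_form_def[abs_def] H_def poly_P algebra_simps)
  also have "\<dots> = (deriv ^^ Suc m) (\<lambda>z. of_real (ln S) * poly P z) (of_real \<tau>) +
      (deriv ^^ Suc m) H (of_real \<tau>)"
    by (rule higher_deriv_add[OF _ H_hol open_log_dom \<tau>_in]) (intro holomorphic_intros)
  also have "(deriv ^^ Suc m) (\<lambda>z. of_real (ln S) * poly P z) (of_real \<tau>) =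
      of_real (ln S) * (deriv ^^ Suc m) (poly P) (of_real \<tau>)"
    by (rule higher_deriv_cmult[of _ UNIV]) (auto intro: holomorphic_intros)
  also have "(deriv ^^ Suc m) (poly P) (of_real \<tau>) = fact (Suc m) * of_real p ^ m * of_real q"
  proof -
    have "degree ((pderiv ^^ Suc m) P) = 0"
      unfolding degree_higher_pderiv P_def using coeff_linear_factor_power(2) by simp
    then obtain c where c: "(pderiv ^^ Suc m) P = [:c:]" by (rule degree_eq_zeroE)
    have "c = coeff ((pderiv ^^ Suc m) P) 0" unfolding c by simp
    also have "\<dots> = pochhammer 1 (Suc m) * coeff P (Suc m)"
      unfolding coeff_higher_pderiv by simp
    also have "\<dots> = fact (Suc m) * (of_real p ^ m * of_real q)"
      unfolding P_def coeff_linear_factor_power(1) by (simp add: pochhammer_fact)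
    finally show ?thesis unfolding higher_deriv_poly c by (simp add: mult.assoc)
  qed
  finally have split: "(deriv ^^ Suc m) log_form (of_real \<tau>) -
      of_real (fact (Suc m) * p ^ m * q * ln S) = (deriv ^^ Suc m) H (of_real \<tau>)"
    by (simp add: algebra_simps)
  \<comment> \<open>On this disc each of \<open>w * p\<close> and \<open>w * q\<close> has norm at
    most \<open>S / 8\<close>. Hence \<open>u\<close> has norm at most 1/4, the linear factors stay
    below \<open>2 * S\<close>, and the quotient \<open>2 * S / \<rho>\<close> is the constant
    \<open>16 * t\<close>.\<close>
  define \<rho> where "\<rho> = S / (8 * t)"
  have \<rho>: "0 < \<rho>" using S t(1) by (simp add: \<rho>_def)
  have on_ball: "z \<in> log_dom \<and> norm (H z) \<le> (2 * S) ^ Suc m" if z: "z \<in> cball (of_real \<tau>) \<rho>" for z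
  proof -
    define w where "w = z - of_real \<tau>"
    have w: "norm w \<le> \<rho>" using z by (simp add: w_def dist_norm norm_minus_commute)
    have zw: "z = of_real \<tau> + w" by (simp add: w_def)
    have lin: "norm (w * of_real a) \<le> S / 8" if "\<bar>a\<bar> \<le> t" for a
    proof -
      have "norm (w * of_real a) = norm w * \<bar>a\<bar>" by (simp add: norm_mult)
      also have "\<dots> \<le> \<rho> * t" using w that \<rho> by (intro mult_mono) auto
      finally show ?thesis using t(1) by (simp add: \<rho>_def)
    qed
    define u where "u = w * of_real (p + q) / of_real S"
    have "norm (w * of_real (p + q)) \<le> S / 4"
      using lin[OF t(2)] lin[OF t(3)] norm_triangle_ineq[of "w * of_real p" "w * of_real q"]
      by (simp add: algebra_simps)
    then have u: "norm u \<le> 1 / 4" using S by (simp add: u_def norm_divide norm_mult divide_simps)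
    have arg: "of_real (x + y) + z * of_real (p + q) = of_real S * (1 + u)"
    proof -
      have "of_real S * u = w * of_real (p + q)" using S by (simp add: u_def)
      then show ?thesis by (simp add: distrib_left zw) (simp add: S_def algebra_simps)
    qed
    have "\<bar>Re u\<bar> \<le> 1 / 4" using u abs_Re_le_cmod[of u] by linarith
    then have "0 < Re (of_real S * (1 + u))" using S by simp
    then have in_dom: "z \<in> log_dom" unfolding log_dom_def mem_Collect_eq arg .
    have "1 + u \<noteq> 0" using \<open>\<bar>Re u\<bar> \<le> 1 / 4\<close> by (auto simp: complex_eq_iff)
    then have "Ln (of_real (x + y) + z * of_real (p + q)) - of_real (ln S) = Ln (1 + u)"
      unfolding arg using S by (simp add: Ln_times_of_real Ln_of_real)
    moreover have "norm (Ln (1 + u)) \<le> 1" using norm_Ln_le[of u] u by simp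
    ultimately have log_le: "norm (Ln (of_real (x + y) + z * of_real (p + q)) - of_real (ln S)) \<le> 1"
      by simp
    \<comment> \<open>At \<tau> both linear factors are nonnegative with sum \<open>S\<close>, so
      each lies between 0 and \<open>S\<close>.\<close>
    have fac: "norm (of_real a + z * of_real b) \<le> 2 * S"
      if "\<bar>b\<bar> \<le> t" "0 \<le> a + \<tau> * b" "a + \<tau> * b \<le> S" for a b
    proof -
      have "of_real a + z * of_real b = of_real (a + \<tau> * b) + w * of_real b"
        by (simp add: zw algebra_simps)
      then have "norm (of_real a + z * of_real b) \<le> \<bar>a + \<tau> * b\<bar> + norm (w * of_real b)"
        by (metis norm_of_real norm_triangle_ineq)
      with lin[OF that(1)] that S show ?thesis by linarith
    qed
    have "norm (of_real x + z * of_real p) \<le> 2 * S" "norm (of_real y + z * of_real q) \<le> 2 * S"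
      using nonneg t by (intro fac; simp add: S_def algebra_simps)+
    then have "norm (poly P z) \<le> (2 * S) ^ m * (2 * S)"
      unfolding poly_P norm_mult norm_power using S by (intro mult_mono power_mono) auto
    then have "norm (H z) \<le> (2 * S) ^ m * (2 * S) * 1"
      unfolding H_def norm_mult using log_le S by (intro mult_mono) auto
    with in_dom show ?thesis by (simp add: mult_ac)
  qed
  have sub: "cball (of_real \<tau>) \<rho> \<subseteq> log_dom" using on_ball by blast
  have "norm ((deriv ^^ Suc m) H (of_real \<tau>)) \<le> fact (Suc m) * (2 * S) ^ Suc m / \<rho> ^ Suc m"
  proof (rule Cauchy_inequality)
    show "H holomorphic_on ball (of_real \<tau>) \<rho>"
      using H_hol sub ball_subset_cball by (blast intro: holomorphic_on_subset)
    show "continuous_on (cball (of_real \<tau>) \<rho>) H"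
      using H_hol sub by (blast intro: holomorphic_on_imp_continuous_on holomorphic_on_subset)
    show "norm (H z) \<le> (2 * S) ^ Suc m" if "norm (of_real \<tau> - z) = \<rho>" for z
      using on_ball[of z] that by (simp add: dist_norm)
  qed (use \<rho> in auto)
  also have "\<dots> = fact (Suc m) * (16 * t) ^ Suc m"
  proof -
    have "2 * S / \<rho> = 16 * t" using S t(1) by (simp add: \<rho>_def field_simps)
    then have "(2 * S) ^ Suc m / \<rho> ^ Suc m = (16 * t) ^ Suc m" by (metis power_divide)
    then show ?thesis by (simp only: times_divide_eq_right[symmetric])
  qed
  finally show ?thesis using split by (simp only: S_def)
qed

text \<open>The mean value form of the difference is applied to the real part of
  \<open>log_form\<close>, and the derivative bound is then used at the intermediate point.\<close>

lemma log_segment_difference: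
  assumes t: "0 < t" "\<bar>p\<bar> \<le> t" "\<bar>q\<bar> \<le> t"
    and nonneg: "\<And>\<tau>. 0 \<le> \<tau> \<Longrightarrow> \<tau> \<le> real (Suc m) \<Longrightarrow> 0 \<le> x + \<tau> * p"
      "\<And>\<tau>. 0 \<le> \<tau> \<Longrightarrow> \<tau> \<le> real (Suc m) \<Longrightarrow> 0 \<le> y + \<tau> * q"
    and pos: "\<And>\<tau>. 0 \<le> \<tau> \<Longrightarrow> \<tau> \<le> real (Suc m) \<Longrightarrow> 0 < x + y + \<tau> * (p + q)"
  obtains \<xi> where "0 \<le> \<xi>" "\<xi> \<le> real (Suc m)"
    "\<bar>(\<Sum>k=0..Suc m. (-1) ^ (Suc m - k) * real (Suc m choose k) *
        ((x + real k * p) ^ m * (y + real k * q) * ln (x + y + real k * (p + q)))) -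
      fact (Suc m) * p ^ m * q * ln (x + y + \<xi> * (p + q))\<bar> \<le> fact (Suc m) * (16 * t) ^ Suc m"
proof -
  define D where "D j \<tau> = Re ((deriv ^^ j) log_form (of_real \<tau>))" for j and \<tau> :: real
  have "(D j has_real_derivative D (Suc j) \<tau>) (at \<tau>)"
    if "0 \<le> \<tau>" "\<tau> \<le> real (Suc m)" for j \<tau>
  proof -
    have "of_real \<tau> \<in> log_dom" using pos[OF that] by (simp add: log_dom_def)
    then have "((deriv ^^ j) log_form has_field_derivative (deriv ^^ Suc j) log_form (of_real \<tau>))
        (at (of_real \<tau>))"
      by (intro has_field_derivative_higher_deriv[OF log_form_holomorphic open_log_dom])
    then show ?thesis
      unfolding D_def by (intro has_field_derivative_Re has_vector_derivative_real_field)
  qed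
  then have "\<exists>\<xi>\<in>{0..real (Suc m)}.
      (\<Sum>k=0..Suc m. (-1) ^ (Suc m - k) * real (Suc m choose k) * D 0 (real k)) = D (Suc m) \<xi>"
    by (intro difference_mean_value)
  then obtain \<xi> where \<xi>: "0 \<le> \<xi>" "\<xi> \<le> real (Suc m)"
    "(\<Sum>k=0..Suc m. (-1) ^ (Suc m - k) * real (Suc m choose k) * D 0 (real k)) = D (Suc m) \<xi>"
    by (auto simp del: sum.atLeast0_atMost_Suc)
  have D0: "D 0 (real k) = (x + real k * p) ^ m * (y + real k * q) * ln (x + y + real k * (p + q))"
    if "k \<in> {0..Suc m}" for k
    using log_form_of_real[of "real k"] pos[of "real k"] that by (simp add: D_def del: of_real_mult)
  let ?L = "fact (Suc m) * p ^ m * q * ln (x + y + \<xi> * (p + q))"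
  have "\<bar>D (Suc m) \<xi> - ?L\<bar> = \<bar>Re ((deriv ^^ Suc m) log_form (of_real \<xi>) - of_real ?L)\<bar>"
    by (simp only: D_def minus_complex.sel Re_complex_of_real)
  also have "\<dots> \<le> norm ((deriv ^^ Suc m) log_form (of_real \<xi>) - of_real ?L)"
    by (rule abs_Re_le_cmod)
  also have "\<dots> \<le> fact (Suc m) * (16 * t) ^ Suc m"
    by (intro log_form_higher_deriv t nonneg pos \<xi>)
  finally have "\<bar>D (Suc m) \<xi> - ?L\<bar> \<le> fact (Suc m) * (16 * t) ^ Suc m" .
  then show thesis
    using \<xi>(1,2) unfolding \<xi>(3)[symmetric] by (intro that[of \<xi>]) (simp_all only: D0 cong: sum.cong)
qed

end

subsection \<open>The logarithmic example\<close>

text \<open>The case of interest is \<open>m = r - 1\<close>. In the cube,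
  \<open>v $ a + v $ b = 0\<close> forces both coordinates to vanish, so for positive
  \<open>m\<close> the value there is 0 whatever \<open>ln 0\<close> is.\<close>

definition log_example :: "nat \<Rightarrow> 'd \<Rightarrow> 'd \<Rightarrow> real^'d \<Rightarrow> real" where
  "log_example m a b v = (v $ a) ^ m * v $ b * ln (v $ a + v $ b)"

lemma square_ln_le:
  fixes s :: real
  assumes "0 \<le> s" "s \<le> 1"
  shows "s * s * \<bar>ln s\<bar> \<le> s"
proof (cases "s = 0")
  case False
  have "- ln s = ln (1 / s)" using False assms by (simp add: ln_div)
  also have "\<dots> \<le> 1 / s - 1" using False assms by (intro ln_le_minus_one) auto
  finally have "s * s * \<bar>ln s\<bar> \<le> s * s * (1 / s)"
    using assms False by (intro mult_left_mono) auto
  with False show ?thesis by simp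
qed simp

text \<open>A majorant that gives continuity where both coordinates vanish. Near there the product
  of the coordinates is at most the square of their sum, which beats the logarithm.\<close>

lemma log_example_le_sum:
  assumes "1 \<le> m" "v \<in> unit_cube"
  shows "\<bar>log_example m a b v\<bar> \<le> v $ a + v $ b"
proof -
  define x y where "x = v $ a" and "y = v $ b"
  have xy: "0 \<le> x" "x \<le> 1" "0 \<le> y" "y \<le> 1" using assms by (auto simp: unit_cube_def x_def y_def)
  have "x ^ m \<le> x ^ 1" using assms xy by (intro power_decreasing) auto
  then have m1: "x ^ m * y \<le> x * y" using xy by (simp add: mult_right_mono)
  have "\<bar>log_example m a b v\<bar> = x ^ m * y * \<bar>ln (x + y)\<bar>"
    using xy by (simp add: log_example_def abs_mult x_def[symmetric] y_def[symmetric])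
  also have "\<dots> \<le> x * y * \<bar>ln (x + y)\<bar>" using m1 by (rule mult_right_mono) simp
  also have "\<dots> \<le> x + y"
  proof (cases "x + y \<le> 1")
    case True
    have "x * y \<le> (x + y) * (x + y)" using xy by (intro mult_mono) auto
    then have "x * y * \<bar>ln (x + y)\<bar> \<le> (x + y) * (x + y) * \<bar>ln (x + y)\<bar>"
      by (rule mult_right_mono) simp
    also have "\<dots> \<le> x + y" using True xy by (intro square_ln_le) auto
    finally show ?thesis .
  next
    case False
    then have "\<bar>ln (x + y)\<bar> \<le> x + y" using ln_le_minus_one[of "x + y"] by simp
    moreover have "x * y \<le> 1" using xy by (simp add: mult_le_one)
    ultimately have "x * y * \<bar>ln (x + y)\<bar> \<le> 1 * (x + y)" using xy by (intro mult_mono) auto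
    then show ?thesis by simp
  qed
  finally show ?thesis by (simp add: x_def y_def)
qed

lemma continuous_on_log_example:
  assumes "1 \<le> m"
  shows "continuous_on unit_cube (log_example m a b)"
  unfolding continuous_on_def
proof
  fix v :: "real^'a"
  assume v: "v \<in> unit_cube"
  have nonneg: "0 \<le> v $ a" "0 \<le> v $ b" using v by (auto simp: unit_cube_def)
  show "(log_example m a b \<longlongrightarrow> log_example m a b v) (at v within unit_cube)"
  proof (cases "v $ a + v $ b = 0")
    case True
    have "((\<lambda>w. w $ a + w $ b) \<longlongrightarrow> v $ a + v $ b) (at v within unit_cube)"
      by (intro tendsto_intros)
    moreover have "\<forall>\<^sub>F w in at v within unit_cube. norm (log_example m a b w) \<le> w $ a + w $ b"
      unfolding eventually_at_filter real_norm_def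
      by (intro always_eventually allI impI log_example_le_sum assms)
    ultimately have "(log_example m a b \<longlongrightarrow> 0) (at v within unit_cube)"
      using True by (intro Lim_null_comparison[of "log_example m a b"]) auto
    then show ?thesis using True by (simp add: log_example_def)
  next
    case False
    then show ?thesis unfolding log_example_def[abs_def] by (intro tendsto_intros) auto
  qed
qed

lemma fwd_diff_log_example:
  "fwd_diff r h (log_example m a b) v =
    (\<Sum>k=0..r. (-1) ^ (r - k) * real (r choose k) *
      ((v $ a + real k * h $ a) ^ m * (v $ b + real k * h $ b) *
        ln (v $ a + v $ b + real k * (h $ a + h $ b))))"
  unfolding fwd_diff_def log_example_def by (simp add: algebra_simps)

lemma segment_nonneg:
  fixes u p \<tau> :: real
  assumes "0 \<le> u" "0 \<le> u + R * p" "0 \<le> \<tau>" "\<tau> \<le> R"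
  shows "0 \<le> u + \<tau> * p"
proof (cases "0 \<le> p")
  case False
  then have "R * p \<le> \<tau> * p" using assms by (intro mult_right_mono_neg) auto
  with assms show ?thesis by linarith
qed (use assms in simp)

text \<open>Along an axis one of \<open>h $ a\<close>, \<open>h $ b\<close> is 0, so the logarithmic
  term disappears and only the Cauchy error of order \<open>t ^ Suc m\<close> remains.\<close>

lemma log_example_axis_diff_le:
  assumes "1 \<le> m" "a \<noteq> b" "0 < t" and v: "v \<in> unit_cube"
    "v + real (Suc m) *\<^sub>R (t *\<^sub>R axis i 1) \<in> unit_cube"
  shows "\<bar>fwd_diff (Suc m) (t *\<^sub>R axis i 1) (log_example m a b) v\<bar> \<le> fact (Suc m) * (16 * t) ^ Suc m"
proof -
  define h :: "real^'a" where "h = t *\<^sub>R axis i 1"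
  have zero: "h $ a = 0 \<or> h $ b = 0" using assms(2) by (auto simp: h_def axis_def)
  have le: "\<bar>h $ a\<bar> \<le> t" "\<bar>h $ b\<bar> \<le> t" using assms(3) by (auto simp: h_def axis_def)
  have seg: "0 \<le> v $ j + \<tau> * h $ j" if "0 \<le> \<tau>" "\<tau> \<le> real (Suc m)" for \<tau> j
  proof (rule segment_nonneg[OF _ _ that])
    show "0 \<le> v $ j" using v(1) by (simp add: unit_cube_def)
    have "0 \<le> (v + real (Suc m) *\<^sub>R h) $ j" using v(2) by (simp only: unit_cube_def mem_Collect_eq h_def)
    then show "0 \<le> v $ j + real (Suc m) * h $ j" by simp
  qed
  show ?thesis
  proof (cases "\<forall>\<tau>. 0 \<le> \<tau> \<longrightarrow> \<tau> \<le> real (Suc m) \<longrightarrow> 0 < v $ a + v $ b + \<tau> * (h $ a + h $ b)")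
    case True
    obtain \<xi> where "\<bar>fwd_diff (Suc m) h (log_example m a b) v -
        fact (Suc m) * (h $ a) ^ m * h $ b * ln (v $ a + v $ b + \<xi> * (h $ a + h $ b))\<bar>
        \<le> fact (Suc m) * (16 * t) ^ Suc m"
      unfolding fwd_diff_log_example
      by (rule log_segment_difference[of t "h $ a" "h $ b" m "v $ a" "v $ b"])
        (use assms(3) le seg[of _ a] seg[of _ b] True in blast)+
    moreover have "(h $ a) ^ m * h $ b = 0" using zero assms(1) by auto
    ultimately have "\<bar>fwd_diff (Suc m) h (log_example m a b) v - fact (Suc m) * 0 * ln (v $ a + v $ b + \<xi> * (h $ a + h $ b))\<bar>
        \<le> fact (Suc m) * (16 * t) ^ Suc m"
      by (simp only: mult.assoc[of "fact (Suc m)"])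
    then show ?thesis unfolding h_def by (simp only: mult_zero_right mult_zero_left diff_zero)
  next
    case False
    then obtain \<tau> where \<tau>: "0 \<le> \<tau>" "\<tau> \<le> real (Suc m)" "v $ a + v $ b + \<tau> * (h $ a + h $ b) \<le> 0"
      by (auto simp: not_less)
    have "(v $ a + \<tau> * h $ a) + (v $ b + \<tau> * h $ b) \<le> 0" using \<tau>(3) by (simp add: algebra_simps)
    then have "v $ a + \<tau> * h $ a = 0" "v $ b + \<tau> * h $ b = 0"
      using seg[OF \<tau>(1,2), of a] seg[OF \<tau>(1,2), of b] by linarith+
    \<comment> \<open>The segment meets the face where the logarithm is singular. One of the two
      coordinates is constant along it, hence identically 0, and all summands vanish.\<close>
    then have "(v $ a = 0 \<and> h $ a = 0) \<or> (v $ b = 0 \<and> h $ b = 0)" using zero by auto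
    then have "fwd_diff (Suc m) h (log_example m a b) v = 0"
      unfolding fwd_diff_log_example using assms(1)
      by (auto simp: power_0_left simp del: sum.atLeast0_atMost_Suc intro!: sum.neutral)
    then show ?thesis using assms(3) by (simp add: h_def)
  qed
qed

lemma Psi_log_example_le:
  assumes "1 \<le> m" "a \<noteq> b"
  shows "Psi (Suc m) (log_example m a b) n \<le>
    fact (Suc m) * 16 ^ Suc m * 2 powr (- of_int n * real (Suc m))"
proof -
  have "Psi (Suc m) (log_example m a b) n \<le> fact (Suc m) * (16 * 2 powi (- n)) ^ Suc m"
    by (intro Psi_least log_example_axis_diff_le assms) simp_all
  also have "\<dots> = fact (Suc m) * 16 ^ Suc m * (2 powi (- n)) ^ Suc m"
    by (simp only: power_mult_distrib mult.assoc)
  also have "(2 powi (- n)) ^ Suc m = (2 powr (- of_int n * real (Suc m)) :: real)"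
    unfolding two_powi_eq_powr by (simp only: powr_realpow[symmetric] powr_gt_zero powr_powr) simp
  finally show ?thesis .
qed

lemma Psi_log_example_bigo:
  assumes "1 \<le> m" "a \<noteq> b"
  shows "Psi (Suc m) (log_example m a b) \<in> O[at_top](\<lambda>n. 2 powr (- of_int n * real (Suc m)))"
proof (rule bigoI[of _ "fact (Suc m) * 16 ^ Suc m"], rule always_eventually, rule allI)
  fix n
  have "norm (Psi (Suc m) (log_example m a b) n) = Psi (Suc m) (log_example m a b) n"
    using Psi_nonneg[OF continuous_on_log_example[OF assms(1)], of "Suc m" a b n] by simp
  also have "\<dots> \<le> fact (Suc m) * 16 ^ Suc m * norm (2 powr (- of_int n * real (Suc m)) :: real)"
    using Psi_log_example_le[OF assms, of n] by simp
  finally show "norm (Psi (Suc m) (log_example m a b) n) \<le>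
      fact (Suc m) * 16 ^ Suc m * norm (2 powr (- of_int n * real (Suc m)) :: real)" .
qed

section \<open>Two-sided bounds for the modulus of the example\<close>

lemma power_ln_le:
  fixes s T :: real
  assumes "0 \<le> s" "s \<le> T" "T \<le> 1" "0 < T"
  shows "s ^ Suc m * \<bar>ln s\<bar> \<le> T ^ Suc m * (1 - ln T)"
proof (cases "s = 0")
  case False
  then have s: "0 < s" using assms by simp
  \<comment> \<open>The excess \<open>ln (T / s)\<close> is at most \<open>T / s\<close>, which one
    factor \<open>s\<close> of the power absorbs.\<close>
  have "- ln s = - ln T + ln (T / s)" using s assms by (simp add: ln_div)
  also have "\<dots> \<le> - ln T + T / s" using ln_le_minus_one[of "T / s"] s assms by simp
  finally have "\<bar>ln s\<bar> \<le> - ln T + T / s" using s assms by simp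
  then have "s ^ Suc m * \<bar>ln s\<bar> \<le> s ^ Suc m * (- ln T + T / s)"
    using s by (intro mult_left_mono) auto
  also have "\<dots> = s ^ Suc m * (- ln T) + s ^ m * T" using s by (simp add: field_simps)
  also have "\<dots> \<le> T ^ Suc m * (- ln T) + T ^ m * T"
    using s assms by (intro add_mono mult_right_mono power_mono) auto
  finally show ?thesis by (simp add: algebra_simps)
next
  case True
  have "ln T \<le> 0" using assms by simp
  then have "0 \<le> 1 - ln T" by linarith
  then have "0 \<le> T ^ Suc m * (1 - ln T)" using assms by (intro mult_nonneg_nonneg) auto
  with True show ?thesis by simp
qed

text \<open>If the segment starts far from the singular face relative to its length, the logarithm
  along it is at most \<bar>ln t\<bar> and the mean value form applies. Otherwise all nodes are
  close to the face and the values themselves are small enough.\<close>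

lemma log_example_diff_le:
  assumes t: "0 < t" "t \<le> exp (- 1)" "6 * real (Suc m) * t \<le> 1"
    and h: "norm h \<le> t" and v: "v \<in> unit_cube" "v + real (Suc m) *\<^sub>R h \<in> unit_cube"
  shows "\<bar>fwd_diff (Suc m) h (log_example m a b) v\<bar> \<le>
    (fact (Suc m) * (1 + 16 ^ Suc m) + 2 ^ Suc m * (2 * (6 * real (Suc m)) ^ Suc m)) * (t ^ Suc m * \<bar>ln t\<bar>)"
proof -
  let ?r = "real (Suc m)"
  define p q s where "p = h $ a" and "q = h $ b" and "s = v $ a + v $ b"
  have pq: "\<bar>p\<bar> \<le> t" "\<bar>q\<bar> \<le> t"
    using h component_le_norm_cart[of h] order_trans by (auto simp: p_def q_def)
  have seg0: "0 \<le> v $ j + \<tau> * h $ j" if "0 \<le> \<tau>" "\<tau> \<le> ?r" for \<tau> j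
  proof (rule segment_nonneg[OF _ _ that])
    show "0 \<le> v $ j" using v(1) by (simp add: unit_cube_def)
    have "0 \<le> (v + ?r *\<^sub>R h) $ j" using v(2) by (simp only: unit_cube_def mem_Collect_eq)
    then show "0 \<le> v $ j + ?r * h $ j" by simp
  qed
  have seg1: "v $ j + \<tau> * h $ j \<le> 1" if "0 \<le> \<tau>" "\<tau> \<le> ?r" for \<tau> j
  proof -
    have "(v + ?r *\<^sub>R h) $ j \<le> 1" using v(2) by (simp only: unit_cube_def mem_Collect_eq)
    then have "0 \<le> (1 - v $ j) + \<tau> * (- h $ j)"
      using v(1) by (intro segment_nonneg[OF _ _ that]) (auto simp: unit_cube_def)
    then show ?thesis by simp
  qed
  have "ln t \<le> ln (exp (- 1))" using t by (intro ln_mono) auto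
  then have lnt: "ln t \<le> - 1" by simp
  have shift: "\<bar>\<tau> * (p + q)\<bar> \<le> 2 * ?r * t" if "0 \<le> \<tau>" "\<tau> \<le> ?r" for \<tau>
  proof -
    have "\<bar>\<tau> * (p + q)\<bar> = \<tau> * \<bar>p + q\<bar>" using that by (simp add: abs_mult)
    also have "\<dots> \<le> ?r * (2 * t)" using that pq by (intro mult_mono) auto
    finally show ?thesis by (simp add: mult_ac)
  qed
  define X where "X = t ^ Suc m * \<bar>ln t\<bar>"
  \<comment> \<open>As \<open>t \<le> exp (- 1)\<close> gives \<bar>ln t\<bar> at least 1, errors of
    order \<open>t ^ Suc m\<close> are absorbed into \<open>X\<close>.\<close>
  have "t ^ Suc m * 1 \<le> X" unfolding X_def using t lnt by (intro mult_left_mono) auto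
  then have X: "0 \<le> X" "t ^ Suc m \<le> X" using t by (auto simp: X_def)
  show ?thesis
  \<comment> \<open>Along the segment the sum of the two coordinates changes by at most
    \<open>2 * ?r * t\<close>. It thus stays above \<open>t\<close> in the far case and below
    \<open>6 * ?r * t\<close> in the near case.\<close>
  proof (cases "s \<le> 4 * ?r * t")
    case False
    have big: "t \<le> s + \<tau> * (p + q)" if "0 \<le> \<tau>" "\<tau> \<le> ?r" for \<tau>
    proof -
      have "t \<le> 2 * ?r * t" using t(1) by (simp add: mult_le_cancel_right1)
      with shift[OF that] False show ?thesis by linarith
    qed
    have segp: "0 \<le> v $ a + \<tau> * p" "0 \<le> v $ b + \<tau> * q" "0 < v $ a + v $ b + \<tau> * (p + q)"
      if "0 \<le> \<tau>" "\<tau> \<le> ?r" for \<tau>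
      unfolding s_def[symmetric] using seg0[OF that] big[OF that] t(1) by (auto simp: p_def q_def)
    obtain \<xi> where \<xi>: "0 \<le> \<xi>" "\<xi> \<le> ?r"
      and diff: "\<bar>fwd_diff (Suc m) h (log_example m a b) v -
        fact (Suc m) * p ^ m * q * ln (s + \<xi> * (p + q))\<bar> \<le> fact (Suc m) * (16 * t) ^ Suc m"
      unfolding fwd_diff_log_example p_def[symmetric] q_def[symmetric] s_def
      by (rule log_segment_difference[OF t(1) pq, of m "v $ a" "v $ b"])
        (use segp in blast)+
    define S where "S = s + \<xi> * (p + q)"
    \<comment> \<open>The logarithm must also be controlled when \<open>S\<close> exceeds 1, where
      it is at most \<open>ln 2\<close>.\<close>
    have "S \<le> 2" using seg1[OF \<xi>, of a] seg1[OF \<xi>, of b]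
      by (simp add: S_def s_def p_def q_def algebra_simps)
    moreover have "t \<le> S" using big[OF \<xi>] by (simp add: S_def)
    ultimately have "ln t \<le> ln S" "ln S \<le> ln 2" using t(1) by auto
    moreover have "ln 2 \<le> (1::real)" using ln_le_minus_one[of "2::real"] by simp
    ultimately have lnS: "\<bar>ln S\<bar> \<le> \<bar>ln t\<bar>" using lnt by linarith
    have "\<bar>p ^ m * q * ln S\<bar> \<le> t ^ m * t * \<bar>ln t\<bar>"
      unfolding abs_mult power_abs using pq lnS t(1) by (intro mult_mono power_mono) auto
    then have main: "\<bar>p ^ m * q * ln S\<bar> \<le> X" by (simp add: X_def mult_ac)
    have "\<bar>fwd_diff (Suc m) h (log_example m a b) v\<bar> \<le>
        \<bar>fact (Suc m) * p ^ m * q * ln S\<bar> + fact (Suc m) * (16 * t) ^ Suc m"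
      using diff unfolding S_def by linarith
    also have "\<bar>fact (Suc m) * p ^ m * q * ln S\<bar> = fact (Suc m) * \<bar>p ^ m * q * ln S\<bar>"
      by (simp only: mult.assoc abs_mult[of "fact (Suc m)"] abs_of_pos[OF fact_gt_zero])
    also have "fact (Suc m) * (16 * t) ^ Suc m = fact (Suc m) * 16 ^ Suc m * t ^ Suc m"
      by (simp only: power_mult_distrib mult.assoc)
    also have "fact (Suc m) * \<bar>p ^ m * q * ln S\<bar> + fact (Suc m) * 16 ^ Suc m * t ^ Suc m \<le>
        fact (Suc m) * X + fact (Suc m) * 16 ^ Suc m * X"
      using main X by (intro add_mono mult_left_mono) auto
    also have "\<dots> = fact (Suc m) * (1 + 16 ^ Suc m) * X" by (simp only: distrib_left distrib_right mult_1_right)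
    also have "\<dots> \<le> (fact (Suc m) * (1 + 16 ^ Suc m) + 2 ^ Suc m * (2 * (6 * ?r) ^ Suc m)) * X"
      using X(1) by (intro mult_right_mono) auto
    finally show ?thesis unfolding X_def .
  next
    case True
    define T where "T = 6 * ?r * t"
    have T: "t \<le> T" "0 < T" "T \<le> 1" using t by (auto simp: T_def mult_le_cancel_right1)
    have "\<bar>fwd_diff (Suc m) h (log_example m a b) v\<bar> \<le> 2 ^ Suc m * (T ^ Suc m * (1 - ln T))"
    proof (rule fwd_diff_abs_le)
      fix k assume "k \<le> Suc m"
      then have k: "0 \<le> real k" "real k \<le> ?r" by auto
      define x y where "x = v $ a + real k * p" and "y = v $ b + real k * q"
      have xy: "0 \<le> x" "0 \<le> y" using seg0[OF k] by (auto simp: x_def y_def p_def q_def)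
      have sum: "x + y = s + real k * (p + q)" by (simp add: x_def y_def s_def algebra_simps)
      have "x + y \<le> T" using shift[OF k] True unfolding sum T_def by linarith
      have "\<bar>log_example m a b (v + real k *\<^sub>R h)\<bar> = x ^ m * y * \<bar>ln (x + y)\<bar>"
        using xy by (simp add: log_example_def x_def y_def p_def q_def abs_mult)
      also have "\<dots> \<le> (x + y) ^ m * (x + y) * \<bar>ln (x + y)\<bar>"
        using xy by (intro mult_mono power_mono) auto
      also have "\<dots> = (x + y) ^ Suc m * \<bar>ln (x + y)\<bar>" by simp
      also have "\<dots> \<le> T ^ Suc m * (1 - ln T)"
        using xy \<open>x + y \<le> T\<close> T by (intro power_ln_le) auto
      finally show "\<bar>log_example m a b (v + real k *\<^sub>R h)\<bar> \<le> T ^ Suc m * (1 - ln T)" .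
    qed
    also have "\<dots> \<le> 2 ^ Suc m * (T ^ Suc m * (2 * \<bar>ln t\<bar>))"
    proof -
      have "ln t \<le> ln T" using T t by auto
      then have "1 - ln T \<le> 2 * \<bar>ln t\<bar>" using lnt by linarith
      then show ?thesis using T by (intro mult_left_mono) auto
    qed
    also have "\<dots> = 2 ^ Suc m * (2 * (6 * ?r) ^ Suc m) * X"
      unfolding T_def X_def power_mult_distrib[of "6 * ?r" t] by (simp only: mult_ac)
    also have "\<dots> \<le> (fact (Suc m) * (1 + 16 ^ Suc m) + 2 ^ Suc m * (2 * (6 * ?r) ^ Suc m)) * X"
      using X(1) by (intro mult_right_mono) auto
    finally show ?thesis unfolding X_def .
  qed
qed

text \<open>On a diagonal segment the main term is a multiple of \<open>t ^ Suc m * ln S\<close>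
  with \<open>S\<close> comparable to \<open>t\<close>; for small \<open>t\<close> it outweighs the
  Cauchy error.\<close>

lemma log_example_modulus_lower:
  fixes a b :: "'d::finite"
  assumes "1 \<le> m" "a \<noteq> b" and t: "0 < t" "real (Suc m) * t \<le> 1 / 2"
    and small: "2 * (ln (2 + real (Suc m)) + 32 ^ Suc m) \<le> - ln t"
  shows "fact (Suc m) / (2 * 2 ^ Suc m) * (t ^ Suc m * \<bar>ln t\<bar>) \<le>
    smooth_modulus (Suc m) (log_example m a b) t"
proof -
  let ?r = "real (Suc m)"
  \<comment> \<open>Two components of size \<open>t / 2\<close> keep the norm within
    \<open>t\<close>. The starting point \<open>v\<close> is off the singular face, but only at
    distance of order \<open>t\<close>.\<close>
  define h :: "real^'d" where "h = axis a (t / 2) + axis b (t / 2)"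
  define v :: "real^'d" where "v = (\<chi> i. t)"
  have hc: "h $ a = t / 2" "h $ b = t / 2" using assms(2) by (auto simp: h_def axis_def)
  have hi: "0 \<le> h $ i" "h $ i \<le> t" for i using t(1) by (auto simp: h_def axis_def)
  have norm_axis: "norm (axis i (t / 2) :: real^'d) = t / 2" for i
  proof -
    have "axis i (t / 2) = (t / 2) *\<^sub>R (axis i 1 :: real^'d)" by (simp add: vec_eq_iff axis_def)
    then show ?thesis using t(1) by simp
  qed
  have "norm h \<le> norm (axis a (t / 2) :: real^'d) + norm (axis b (t / 2) :: real^'d)"
    unfolding h_def by (rule norm_triangle_ineq)
  then have h: "norm h \<le> t" using t(1) by (simp add: norm_axis)
  have "t \<le> ?r * t" using t(1) by (simp add: mult_le_cancel_right1)
  then have "t \<le> 1 / 2" using t(2) by linarith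
  then have v: "v \<in> unit_cube" using t(1) by (simp add: unit_cube_def v_def)
  have vh: "v + ?r *\<^sub>R h \<in> unit_cube"
    unfolding unit_cube_def mem_Collect_eq
  proof
    fix i
    have "?r * h $ i \<le> ?r * t" using hi by (intro mult_left_mono) auto
    moreover have "0 \<le> ?r * h $ i" using hi by (intro mult_nonneg_nonneg) auto
    ultimately have "t + ?r * h $ i \<le> 1" "0 \<le> t + ?r * h $ i"
      using t \<open>t \<le> 1 / 2\<close> by linarith+
    then show "0 \<le> (v + ?r *\<^sub>R h) $ i \<and> (v + ?r *\<^sub>R h) $ i \<le> 1"
      unfolding vector_add_component vector_scaleR_component
      by (simp add: v_def del: of_nat_Suc)
  qed
  obtain \<xi> where \<xi>: "0 \<le> \<xi>" "\<xi> \<le> ?r"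
    and diff: "\<bar>fwd_diff (Suc m) h (log_example m a b) v -
      fact (Suc m) * (t / 2) ^ m * (t / 2) * ln (t + t + \<xi> * (t / 2 + t / 2))\<bar> \<le>
      fact (Suc m) * (16 * t) ^ Suc m"
    unfolding fwd_diff_log_example hc
    by (rule log_segment_difference[of t "t / 2" "t / 2" m t t])
      (use t(1) in \<open>auto simp: v_def add_pos_nonneg simp del: fact_Suc power_Suc sum.atLeast0_atMost_Suc\<close>)
  define S where "S = t + t + \<xi> * (t / 2 + t / 2)"
  have "\<xi> * t \<le> ?r * t" using \<xi> t(1) by (intro mult_right_mono) auto
  then have "S \<le> (2 + ?r) * t" by (simp add: S_def algebra_simps)
  moreover have "0 < S" using \<xi> t(1) by (simp add: S_def add_pos_nonneg)
  ultimately have "ln S \<le> ln ((2 + ?r) * t)" by (intro ln_mono) auto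
  also have "\<dots> = ln (2 + ?r) + ln t" using t(1) by (intro ln_mult_pos) auto
  finally have lnS: "- ln t - ln (2 + ?r) \<le> - ln S" by linarith
  \<comment> \<open>By \<open>small\<close>, the losses \<open>ln (2 + ?r)\<close> and
    \<open>32 ^ Suc m\<close> together use up at most half of \<open>- ln t\<close>. The number 32
    is the Cauchy constant 16 measured in units of \<open>t / 2\<close>.\<close>
  have "fact (Suc m) * t ^ Suc m / 2 ^ Suc m * (- ln t / 2) \<le>
      fact (Suc m) * t ^ Suc m / 2 ^ Suc m * (- ln S - 32 ^ Suc m)"
    using lnS small t(1) by (intro mult_left_mono) auto
  also have "\<dots> = - (fact (Suc m) * (t / 2) ^ m * (t / 2) * ln S) - fact (Suc m) * (16 * t) ^ Suc m"
  proof -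
    have pow16: "(16 * t) ^ Suc m = t ^ Suc m / 2 ^ Suc m * 32 ^ Suc m"
    proof -
      have "16 * t = t / 2 * 32" by simp
      then show ?thesis by (simp only: power_mult_distrib power_divide)
    qed
    have half: "(t / 2) ^ m * (t / 2) = t ^ Suc m / 2 ^ Suc m" by (simp add: power_divide mult.commute)
    have assoc: "fact (Suc m) * (t / 2) ^ m * (t / 2) * ln S = fact (Suc m) * ((t / 2) ^ m * (t / 2)) * ln S"
      by (simp only: mult.assoc)
    show ?thesis
      unfolding pow16 assoc half by (simp add: right_diff_distrib diff_divide_distrib mult_ac del: fact_Suc power_Suc)
  qed
  also have "\<dots> \<le> \<bar>fwd_diff (Suc m) h (log_example m a b) v\<bar>" using diff unfolding S_def by linarith
  also have "\<dots> \<le> smooth_modulus (Suc m) (log_example m a b) t"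
    by (rule smooth_modulus_upper[OF continuous_on_log_example[OF assms(1)] h v vh])
  finally have le: "fact (Suc m) * t ^ Suc m / 2 ^ Suc m * (- ln t / 2) \<le>
      smooth_modulus (Suc m) (log_example m a b) t" .
  have "ln t \<le> 0" using small t(1) \<open>t \<le> 1 / 2\<close> by simp
  then show ?thesis using le by (simp add: algebra_simps del: fact_Suc power_Suc)
qed

lemma log_example_modulus_lower_eventually:
  fixes a b :: "'d::finite"
  assumes "1 \<le> m" "a \<noteq> b"
  obtains c t0 where "0 < c" "0 < t0"
    "\<And>t. 0 < t \<Longrightarrow> t < t0 \<Longrightarrow> c * (t ^ Suc m * \<bar>ln t\<bar>) \<le> smooth_modulus (Suc m) (log_example m a b) t"
proof
  let ?L = "2 * (ln (2 + real (Suc m)) + 32 ^ Suc m)"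
  \<comment> \<open>The two entries encode that the segment fits into the cube and that the
    logarithm outweighs the error.\<close>
  let ?t0 = "min (1 / (2 * real (Suc m))) (exp (- ?L))"
  show "0 < fact (Suc m) / (2 * 2 ^ Suc m :: real)" by simp
  show "0 < ?t0" by simp
  fix t :: real
  assume t: "0 < t" "t < ?t0"
  have "ln t \<le> ln (exp (- ?L))" using t by (intro ln_mono) auto
  then have "?L \<le> - ln t" by simp
  moreover have "real (Suc m) * t \<le> 1 / 2" using t by (simp add: field_simps del: of_nat_Suc)
  ultimately show "fact (Suc m) / (2 * 2 ^ Suc m) * (t ^ Suc m * \<bar>ln t\<bar>) \<le>
      smooth_modulus (Suc m) (log_example m a b) t"
    by (intro log_example_modulus_lower assms t(1))
qed

lemma log_example_modulus_bigtheta: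
  fixes a b :: "'d::finite"
  assumes "1 \<le> m" "a \<noteq> b"
  shows "smooth_modulus (Suc m) (log_example m a b) \<in> \<Theta>[at_right 0](\<lambda>t. t ^ Suc m * \<bar>ln t\<bar>)"
proof (rule bigthetaI)
  let ?g = "log_example m a b"
  let ?C = "fact (Suc m) * (1 + 16 ^ Suc m) + 2 ^ Suc m * (2 * (6 * real (Suc m)) ^ Suc m) :: real"
  have nonneg: "0 \<le> smooth_modulus (Suc m) ?g t" if "0 \<le> t" for t
    by (rule smooth_modulus_nonneg[OF continuous_on_log_example[OF assms(1)] that])
  let ?t0 = "min (exp (- 1)) (1 / (6 * real (Suc m))) :: real"
  have "\<forall>\<^sub>F t in at_right 0. t \<in> {0<..<?t0}"
    by (rule eventually_at_right_real) simp
  then have "\<forall>\<^sub>F t in at_right 0.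
      norm (smooth_modulus (Suc m) ?g t) \<le> ?C * norm (t ^ Suc m * \<bar>ln t\<bar>)"
  proof eventually_elim
    fix t :: real
    assume t: "t \<in> {0<..<?t0}"
    then have t': "0 < t" "t \<le> exp (- 1)" "6 * real (Suc m) * t \<le> 1"
      by (auto simp: field_simps simp del: of_nat_Suc)
    have "smooth_modulus (Suc m) ?g t \<le> ?C * (t ^ Suc m * \<bar>ln t\<bar>)"
      using t' by (intro smooth_modulus_least log_example_diff_le) auto
    then show "norm (smooth_modulus (Suc m) ?g t) \<le> ?C * norm (t ^ Suc m * \<bar>ln t\<bar>)"
      using nonneg[of t] t'(1) by (simp add: abs_mult del: fact_Suc power_Suc)
  qed
  then show "smooth_modulus (Suc m) ?g \<in> O[at_right 0](\<lambda>t. t ^ Suc m * \<bar>ln t\<bar>)" by (rule bigoI)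
  obtain c t0 where c: "0 < c" "0 < t0"
    "\<And>t. 0 < t \<Longrightarrow> t < t0 \<Longrightarrow> c * (t ^ Suc m * \<bar>ln t\<bar>) \<le> smooth_modulus (Suc m) ?g t"
    using log_example_modulus_lower_eventually[OF assms] by blast
  show "smooth_modulus (Suc m) ?g \<in> \<Omega>[at_right 0](\<lambda>t. t ^ Suc m * \<bar>ln t\<bar>)"
  proof (rule landau_omega.bigI[OF c(1)])
    have "\<forall>\<^sub>F t in at_right 0. t \<in> {0<..<t0}"
      by (rule eventually_at_right_real[OF c(2)])
    then show "\<forall>\<^sub>F t in at_right 0. norm (smooth_modulus (Suc m) ?g t) \<ge> c * norm (t ^ Suc m * \<bar>ln t\<bar>)"
    proof eventually_elim
      fix t :: real
      assume t: "t \<in> {0<..<t0}"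
      then show "norm (smooth_modulus (Suc m) ?g t) \<ge> c * norm (t ^ Suc m * \<bar>ln t\<bar>)"
        using c(3)[of t] nonneg[of t] by (simp add: abs_mult)
    qed
  qed
qed

section \<open>Failure of the estimate without the coarse sum\<close>

lemma log_example_no_estimate:
  fixes a b :: "'d::finite"
  assumes "1 \<le> m" "a \<noteq> b"
  shows "\<not> (\<exists>M. \<forall>(n::int) t. 2 powi (- n - 1) < t \<longrightarrow> t \<le> 2 powi (- n) \<longrightarrow>
    ennreal (smooth_modulus (Suc m) (log_example m a b) t) \<le>
      ennreal M * (Psi_tail (Suc m) (log_example m a b) n +
        ennreal (t ^ Suc m * cube_norm (log_example m a b))))"
proof
  let ?g = "log_example m a b"
  let ?r = "real (Suc m)"
  assume "\<exists>M. \<forall>(n::int) t. 2 powi (- n - 1) < t \<longrightarrow> t \<le> 2 powi (- n) \<longrightarrow>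
    ennreal (smooth_modulus (Suc m) ?g t) \<le>
      ennreal M * (Psi_tail (Suc m) ?g n + ennreal (t ^ Suc m * cube_norm ?g))"
  then obtain M where M: "\<And>(n::int) t. 2 powi (- n - 1) < t \<Longrightarrow> t \<le> 2 powi (- n) \<Longrightarrow>
    ennreal (smooth_modulus (Suc m) ?g t) \<le>
      ennreal M * (Psi_tail (Suc m) ?g n + ennreal (t ^ Suc m * cube_norm ?g))" by blast
  obtain c t0 where c: "0 < c" "0 < t0"
    "\<And>t. 0 < t \<Longrightarrow> t < t0 \<Longrightarrow> c * (t ^ Suc m * \<bar>ln t\<bar>) \<le> smooth_modulus (Suc m) ?g t"
    using log_example_modulus_lower_eventually[OF assms] by blast
  define D where "D = fact (Suc m) * 16 ^ Suc m / (1 - 2 powr - ?r)"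
  have "2 powr - ?r < (1::real)" by (intro powr_less_one) auto
  then have D: "0 \<le> D" by (simp add: D_def)
  define N where "N = max 0 (cube_norm ?g)"
  have N: "0 \<le> N" "cube_norm ?g \<le> N" by (auto simp: N_def)
  \<comment> \<open>At \<open>t = 2 powi (- int k)\<close> the assumed right-hand side is of order
    \<open>t ^ Suc m\<close>, whereas the modulus carries the extra factor \<bar>ln t\<bar>, equal
    to \<open>k * ln 2\<close>. Dividing by \<open>t ^ Suc m\<close> would bound
    \<open>k\<close>.\<close>
  have bound: "c * ln 2 * real k \<le> max 0 M * (D + N)" if k: "(1/2) ^ k < t0" for k :: nat
  proof -
    define t :: real where "t = (1/2) ^ k"
    have t: "0 < t" "t < t0" using k by (auto simp: t_def)
    have t_powi: "t = 2 powi (- int k)" by (simp add: t_def power_int_minus power_one_over field_simps)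
    have t_pow: "2 powr (- of_int (int k) * ?r) = t ^ Suc m"
    proof -
      have "t = 2 powr (- real k)" using t_powi by (simp add: two_powi_eq_powr)
      then show ?thesis by (simp add: powr_realpow[symmetric] powr_powr del: power_Suc of_nat_Suc)
    qed
    have "Psi_tail (Suc m) ?g (int k) \<le> ennreal (D * 2 powr (- of_int (int k) * ?r))"
      unfolding D_def by (rule Psi_tail_le_geometric[OF Psi_log_example_le[OF assms]]) auto
    then have "Psi_tail (Suc m) ?g (int k) \<le> ennreal (D * t ^ Suc m)" unfolding t_pow .
    moreover have "ennreal (t ^ Suc m * cube_norm ?g) \<le> ennreal (t ^ Suc m * N)"
      using t N by (intro ennreal_leI mult_left_mono) auto
    ultimately have "Psi_tail (Suc m) ?g (int k) + ennreal (t ^ Suc m * cube_norm ?g) \<le>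
        ennreal (D * t ^ Suc m) + ennreal (t ^ Suc m * N)"
      by (intro add_mono)
    also have "\<dots> = ennreal (D * t ^ Suc m + t ^ Suc m * N)"
      using D N t by (intro ennreal_plus[symmetric]) auto
    finally have le: "Psi_tail (Suc m) ?g (int k) + ennreal (t ^ Suc m * cube_norm ?g) \<le>
        ennreal (D * t ^ Suc m + t ^ Suc m * N)" .
    have "smooth_modulus (Suc m) ?g t \<le> max 0 M * (D * t ^ Suc m + t ^ Suc m * N)"
    proof (rule ennreal_le_mult_bound[OF M le])
      show "2 powi (- int k - 1) < t" unfolding t_powi two_powi_eq_powr by simp
    qed (use t_powi D N t in auto)
    then have "c * (t ^ Suc m * \<bar>ln t\<bar>) \<le> max 0 M * (D * t ^ Suc m + t ^ Suc m * N)"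
      using c(3)[OF t] by linarith
    then have "t ^ Suc m * (c * \<bar>ln t\<bar>) \<le> t ^ Suc m * (max 0 M * (D + N))"
      by (simp add: algebra_simps del: power_Suc)
    then have "c * \<bar>ln t\<bar> \<le> max 0 M * (D + N)"
      using t(1) by (simp only: mult_le_cancel_left_pos zero_less_power)
    moreover have "\<bar>ln t\<bar> = real k * ln 2" by (simp add: t_def ln_realpow ln_div abs_mult)
    ultimately show ?thesis by (simp add: mult_ac)
  qed
  have "(\<lambda>k. (1/2) ^ k) \<longlonglongrightarrow> (0::real)" by (rule LIMSEQ_realpow_zero) auto
  then have "\<forall>\<^sub>F k in sequentially. (1/2) ^ k < t0" using c(2) by (rule order_tendstoD)
  moreover have "\<forall>\<^sub>F k in sequentially. max 0 M * (D + N) / (c * ln 2) < real k"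
    using filterlim_real_sequentially by (simp add: filterlim_at_top_dense)
  ultimately have "\<forall>\<^sub>F k in sequentially. False"
  proof eventually_elim
    fix k :: nat
    assume k: "(1/2) ^ k < t0" "max 0 M * (D + N) / (c * ln 2) < real k"
    have "max 0 M * (D + N) < c * ln 2 * real k"
      using k(2) c(1) by (simp add: divide_less_eq mult_ac)
    with bound[OF k(1)] show False by linarith
  qed
  then show False by simp
qed

theorem corollary5p3:
  fixes f :: "real^'d \<Rightarrow> real" and r :: nat
  assumes r: "1 \<le> r" and f: "continuous_on unit_cube f"
  shows
    \<comment> \<open>(i)\<close>
    "(\<forall>\<alpha>::real. 0 < \<alpha> \<and> \<alpha> \<le> real r \<and>
        Psi r f \<in> O[at_top](\<lambda>n. 2 powr (- of_int n * \<alpha>)) \<longrightarrow>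
        (\<exists>M1. estimate_A M1 r f) \<longrightarrow>
        (\<exists>C. \<forall>\<^sub>F t in at_right 0. \<forall>i x.
           x \<in> unit_cube \<and> x + (real r * t) *\<^sub>R axis i 1 \<in> unit_cube \<longrightarrow>
           \<bar>fwd_diff r (t *\<^sub>R axis i 1) f x\<bar> \<le> C * t powr \<alpha>))
     \<and> \<comment> \<open>(ii)\<close>
     (\<forall>\<alpha>::real. 0 < \<alpha> \<and> \<alpha> < real r \<and>
        Psi r f \<in> O[at_top](\<lambda>n. 2 powr (- of_int n * \<alpha>)) \<longrightarrow>
        (\<exists>M2. estimate_B M2 r f) \<longrightarrow>
        smooth_modulus r f \<in> O[at_right 0](\<lambda>t. t powr \<alpha>))
     \<and> \<comment> \<open>(iii)\<close>
     (1 < CARD('d) \<and> 1 < r \<longrightarrow>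
        (\<exists>g :: real^'d \<Rightarrow> real. continuous_on unit_cube g \<and>
           Psi r g \<in> O[at_top](\<lambda>n. 2 powr (- of_int n * real r)) \<and>
           smooth_modulus r g \<in> \<Theta>[at_right 0](\<lambda>t. t ^ r * \<bar>ln t\<bar>) \<and>
           \<not> (\<exists>M. \<forall>(n::int) t. 2 powi (- n - 1) < t \<longrightarrow> t \<le> 2 powi (- n) \<longrightarrow>
                ennreal (smooth_modulus r g t) \<le> ennreal M * Psi_tail r g n) \<and>
           \<not> (\<exists>M. \<forall>(n::int) t. 2 powi (- n - 1) < t \<longrightarrow> t \<le> 2 powi (- n) \<longrightarrow>
                ennreal (smooth_modulus r g t) \<le>
                  ennreal M * (Psi_tail r g n + ennreal (t ^ r * cube_norm g)))))
     \<and> \<comment> \<open>(iv)\<close>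
     (\<forall>\<alpha>::real. 0 < \<alpha> \<and> \<alpha> \<le> 1 \<and>
        Psi 1 f \<in> O[at_top](\<lambda>n. 2 powr (- of_int n * \<alpha>)) \<longrightarrow>
        smooth_modulus 1 f \<in> O[at_right 0](\<lambda>t. t powr \<alpha>))"
proof (intro conjI allI impI)
  fix \<alpha> :: real
  assume "0 < \<alpha> \<and> \<alpha> \<le> real r \<and> Psi r f \<in> O[at_top](\<lambda>n. 2 powr (- of_int n * \<alpha>))"
    "\<exists>M1. estimate_A M1 r f"
  then show "\<exists>C. \<forall>\<^sub>F t in at_right 0. \<forall>i x.
           x \<in> unit_cube \<and> x + (real r * t) *\<^sub>R axis i 1 \<in> unit_cube \<longrightarrow>
           \<bar>fwd_diff r (t *\<^sub>R axis i 1) f x\<bar> \<le> C * t powr \<alpha>"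
    using axis_diff_bound_of_estimate_A by blast
next
  fix \<alpha> :: real
  assume "0 < \<alpha> \<and> \<alpha> < real r \<and> Psi r f \<in> O[at_top](\<lambda>n. 2 powr (- of_int n * \<alpha>))"
    "\<exists>M2. estimate_B M2 r f"
  then show "smooth_modulus r f \<in> O[at_right 0](\<lambda>t. t powr \<alpha>)"
    using smooth_modulus_bigo_of_estimate_B[OF f r] by blast
next
  fix \<alpha> :: real
  assume "0 < \<alpha> \<and> \<alpha> \<le> 1 \<and> Psi 1 f \<in> O[at_top](\<lambda>n. 2 powr (- of_int n * \<alpha>))"
  then show "smooth_modulus 1 f \<in> O[at_right 0](\<lambda>t. t powr \<alpha>)"
    using modulus_of_continuity_bigo[OF f] by blast
next
  assume dr: "1 < CARD('d) \<and> 1 < r"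
  then obtain a b :: 'd where ab: "a \<noteq> b"
    by (metis card_2_iff' ex_card Suc_1 Suc_leI)
  \<comment> \<open>The exponent is \<open>r - 1\<close>; it is positive because
    \<open>r > 1\<close>, as continuity and the axis bound require.\<close>
  obtain m where m: "r = Suc m" "1 \<le> m" using dr by (cases r) auto
  let ?g = "log_example m a b"
  have no: "\<not> (\<exists>M. \<forall>(n::int) t. 2 powi (- n - 1) < t \<longrightarrow> t \<le> 2 powi (- n) \<longrightarrow>
      ennreal (smooth_modulus r ?g t) \<le>
        ennreal M * (Psi_tail r ?g n + ennreal (t ^ r * cube_norm ?g)))"
    unfolding m(1) by (rule log_example_no_estimate[OF m(2) ab])
  \<comment> \<open>Adding the nonnegative norm term only weakens an estimate, so this failure
    follows from \<open>no\<close>.\<close>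
  have no': "\<not> (\<exists>M. \<forall>(n::int) t. 2 powi (- n - 1) < t \<longrightarrow> t \<le> 2 powi (- n) \<longrightarrow>
      ennreal (smooth_modulus r ?g t) \<le> ennreal M * Psi_tail r ?g n)"
  proof
    assume "\<exists>M. \<forall>(n::int) t. 2 powi (- n - 1) < t \<longrightarrow> t \<le> 2 powi (- n) \<longrightarrow>
        ennreal (smooth_modulus r ?g t) \<le> ennreal M * Psi_tail r ?g n"
    moreover have "ennreal M * Psi_tail r ?g n \<le>
        ennreal M * (Psi_tail r ?g n + ennreal (t ^ r * cube_norm ?g))" for M n t
      by (intro mult_left_mono) auto
    ultimately show False using no by (meson order_trans)
  qed
  show "\<exists>g :: real^'d \<Rightarrow> real. continuous_on unit_cube g \<and>
           Psi r g \<in> O[at_top](\<lambda>n. 2 powr (- of_int n * real r)) \<and>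
           smooth_modulus r g \<in> \<Theta>[at_right 0](\<lambda>t. t ^ r * \<bar>ln t\<bar>) \<and>
           \<not> (\<exists>M. \<forall>(n::int) t. 2 powi (- n - 1) < t \<longrightarrow> t \<le> 2 powi (- n) \<longrightarrow>
                ennreal (smooth_modulus r g t) \<le> ennreal M * Psi_tail r g n) \<and>
           \<not> (\<exists>M. \<forall>(n::int) t. 2 powi (- n - 1) < t \<longrightarrow> t \<le> 2 powi (- n) \<longrightarrow>
                ennreal (smooth_modulus r g t) \<le>
                  ennreal M * (Psi_tail r g n + ennreal (t ^ r * cube_norm g)))"
    by (intro exI[of _ ?g] conjI no no' continuous_on_log_example[OF m(2)]
        Psi_log_example_bigo[OF m(2) ab, folded m(1)]
        log_example_modulus_bigtheta[OF m(2) ab, folded m(1)])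
qed

end
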